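(* There exists a surjective homomorphism $\Phi\colon \mathrm{Com}^+(F)\to\mathbb{Q}^*\times\mathbb{Q}^*$ defined by $$\Phi(f)=\left(\frac pq,\frac{p'}{q'}\right),$$ where, for $f\in\mathrm{Com}^+(F)$, $p,q,p',q'$ are positive integers such that for some real number $M$ one has $f(t+p)=f(t)+q$ for all $t>M$ and $f(t+p')=f(t)+q'$ for all $t<-M$.
   Context: $\mathbb{Q}^*$ denotes the multiplicative group of positive rational numbers. $P$ denotes the group (under composition) of all homeomorphisms $f$ from $\mathbb{R}$ to itself that (1) are piecewise linear with a discrete, possibly infinite, set of breakpoints (finitely many in every bounded interval); (2) use only slopes that are, up to sign, integral powers of $2$; (3) have all breakpoints in $\mathbb{Z}[\frac12]$; (4) satisfy $f(\mathbb{Z}[\frac12])\subset\mathbb{Z}[\frac12]$. Thompson's group $F$ is the subgroup of those order-preserving $f\in P$ for which there exist $l,r\in\mathbb{Z}$ and $M>0$ with $f(t)=t+r$ for all $t>M$ and $f(t)=t+l$ for all $t<-M$. The abstract commensurator $\mathrm{Com}(F)$ is the group of isomorphisms between finite-index subgroups of $F$, modulo agreement on a finite-index subgroup, under composition where defined. It is identified with the group $\mathrm{Com}_P(F)$ of all $h\in P$ such that $F\cap h^{-1}Fh$ has finite index in both $F$ and $h^{-1}Fh$: each commensuration is induced by conjugation by a unique such element. This group consists exactly of the elements $f\in P$ that are eventually integrally periodically affine, meaning that there are non-zero integers $p,q,p',q'$ and a real $M>0$ with $f(t+p)=f(t)+q$ for all $t>M$ and $f(t+p')=f(t)+q'$ for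 all $t<-M$. $\mathrm{Com}^+(F)$ is the index-two subgroup of $\mathrm{Com}(F)$ of commensurations induced by conjugation by orientation-preserving piecewise-linear maps; under the identification it is the group of order-preserving eventually integrally periodically affine elements of $P$. For such elements the integers $p,q,p',q'$ can be chosen positive. *)

theory Defs
  imports "HOL-Analysis.Analysis" "HOL-Algebra.Coset"
begin

definition finite_index :: "('a, 'b) monoid_scheme \<Rightarrow> 'a set \<Rightarrow> bool" where
  "finite_index G H \<longleftrightarrow> subgroup H G \<and> finite (rcosets\<^bsub>G\<^esub> H)"

text \<open>A triple \<open>(A, B, \<phi>)\<close> stands for the isomorphism \<open>\<phi>\<close> from \<open>A\<close> to \<open>B\<close>; the values of \<open>\<phi>\<close>
  outside \<open>A\<close> are junk, which the relation \<open>comm_rel\<close> below ignores.\<close>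

type_synonym 'a partial_iso = "'a set \<times> 'a set \<times> ('a \<Rightarrow> 'a)"

definition partial_isos :: "('a, 'b) monoid_scheme \<Rightarrow> 'a partial_iso set" where
  "partial_isos G = {(A, B, \<phi>). finite_index G A \<and> finite_index G B \<and>
     \<phi> \<in> iso (G\<lparr>carrier := A\<rparr>) (G\<lparr>carrier := B\<rparr>)}"

definition comm_rel :: "('a, 'b) monoid_scheme \<Rightarrow> ('a partial_iso \<times> 'a partial_iso) set" where
  "comm_rel G = {((A, B, \<phi>), (A', B', \<phi>')).
     (A, B, \<phi>) \<in> partial_isos G \<and> (A', B', \<phi>') \<in> partial_isos G \<and>
     (\<exists>C. finite_index G C \<and> C \<subseteq> A \<inter> A' \<and> (\<forall>g\<in>C. \<phi> g = \<phi>' g))}"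

text \<open>Composition where defined: first \<open>\<phi>'\<close>, then \<open>\<phi>\<close>.\<close>

fun partial_comp :: "'a partial_iso \<Rightarrow> 'a partial_iso \<Rightarrow> 'a partial_iso" where
  "partial_comp (A, B, \<phi>) (A', B', \<phi>') = ({g \<in> A'. \<phi>' g \<in> A}, \<phi> ` (A \<inter> B'), \<phi> \<circ> \<phi>')"

definition abstract_commensurator :: "('a, 'b) monoid_scheme \<Rightarrow> 'a partial_iso set monoid" where
  "abstract_commensurator G =
    \<lparr>carrier = partial_isos G // comm_rel G,
     mult = (\<lambda>X Y. \<Union>x\<in>X. \<Union>y\<in>Y. comm_rel G `` {partial_comp x y}),
     one = comm_rel G `` {(carrier G, carrier G, id)}\<rparr>"

definition dyadics :: "real set" where
  "dyadics = {x. \<exists>(a::int) (n::nat). x = of_int a / 2 ^ n}"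

definition affine_near :: "(real \<Rightarrow> real) \<Rightarrow> real \<Rightarrow> real \<Rightarrow> bool" where
  "affine_near f m x \<longleftrightarrow> (\<exists>c. \<forall>\<^sub>F y in nhds x. f y = m * y + c)"

definition breakpoints :: "(real \<Rightarrow> real) \<Rightarrow> real set" where
  "breakpoints f = {x. \<nexists>m. affine_near f m x}"

definition PL2 :: "(real \<Rightarrow> real) set" where
  "PL2 = {f. (\<exists>g. homeomorphism UNIV UNIV f g) \<and>
     (\<forall>a b. finite (breakpoints f \<inter> {a..b})) \<and>
     (\<forall>m x. affine_near f m x \<longrightarrow> (\<exists>k::int. \<bar>m\<bar> = 2 powi k)) \<and>
     breakpoints f \<subseteq> dyadics \<and>
     f ` dyadics \<subseteq> dyadics}"

definition thompson_F :: "(real \<Rightarrow> real) monoid" where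
  "thompson_F =
    \<lparr>carrier = {f \<in> PL2. strict_mono f \<and>
       (\<exists>(l::int) (r::int) (M::real). M > 0 \<and>
          (\<forall>t>M. f t = t + of_int r) \<and> (\<forall>t. t < - M \<longrightarrow> f t = t + of_int l))},
     mult = (\<circ>),
     one = id\<rparr>"

text \<open>The commensuration \<open>c\<close> is induced by \<open>g \<mapsto> f g f\<^sup>-\<^sup>1\<close>. Conjugation by \<open>f\<close> need only
  be defined on some finite-index subgroup of \<open>F\<close>, hence the existential quantifier over
  representatives of the class \<open>c\<close>.\<close>

definition induces :: "(real \<Rightarrow> real) \<Rightarrow> (real \<Rightarrow> real) partial_iso set \<Rightarrow> bool" where
  "induces f c \<longleftrightarrow> (\<exists>A B \<phi>. (A, B, \<phi>) \<in> c \<and> (\<forall>g\<in>A. \<phi> g = f \<circ> g \<circ> inv_into UNIV f))"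

definition Com_plus_F :: "(real \<Rightarrow> real) partial_iso set monoid" where
  "Com_plus_F = (abstract_commensurator thompson_F)
    \<lparr>carrier := {c \<in> carrier (abstract_commensurator thompson_F).
       \<exists>f\<in>PL2. strict_mono f \<and> induces f c}\<rparr>"

definition eventually_int_periodic_affine :: "(real \<Rightarrow> real) \<Rightarrow> int \<Rightarrow> int \<Rightarrow> int \<Rightarrow> int \<Rightarrow> bool" where
  "eventually_int_periodic_affine f p q p' q' \<longleftrightarrow>
    (\<exists>M::real. (\<forall>t>M. f (t + of_int p) = f t + of_int q) \<and>
               (\<forall>t. t < - M \<longrightarrow> f (t + of_int p') = f t + of_int q'))"

definition pos_rat_group :: "rat monoid" where
  "pos_rat_group = \<lparr>carrier = {x. x > 0}, mult = (*), one = 1\<rparr>"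

end

theory Submission
  imports Defs
begin

text \<open>
  Let \<open>f\<close> induce a commensuration of \<open>F\<close>. Some translation \<open>t \<mapsto> t + n\<close> with \<open>n > 0\<close> lies in the
  finite-index domain, and its conjugate by \<open>f\<close> lies in \<open>F\<close>, hence is a translation by an integer
  \<open>s\<close> near each end of the line: \<open>f (t + n) = f t + s\<close> there. The conjugate depends only on the
  commensuration, and \<open>n / s\<close> only on \<open>f\<close>, so the ratio is well defined without appeal to the
  uniqueness of the inducing map; it is multiplicative under composition.

  Conversely, if \<open>f\<close> is eventually integrally periodically affine with periods \<open>p\<close>, \<open>p'\<close>, then
  conjugation by \<open>f\<close> carries \<open>g \<in> F\<close> into \<open>F\<close> as soon as the translation lengths of \<open>g\<close> at the two
  ends are divisible by \<open>p\<close> and \<open>p'\<close>, a condition of finite index. A map with prescribed ratios is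
  the piecewise linear interpolation of \<open>m \<mapsto> 2 powi k * \<lfloor>y * m\<rfloor>\<close> with \<open>1 \<le> y < 2\<close>, whose slopes are
  \<open>2 powi k\<close> and \<open>2 powi (k + 1)\<close>.
\<close>

section \<open>Finite-index subgroups and the abstract commensurator\<close>

context group
begin

lemma finite_index_subgroup: "finite_index G A \<Longrightarrow> subgroup A G"
  by (simp add: finite_index_def)

lemma finite_index_rcosets: "finite_index G A \<Longrightarrow> finite (rcosets A)"
  by (simp add: finite_index_def)

lemma finite_index_subset: "finite_index G A \<Longrightarrow> A \<subseteq> carrier G"
  using finite_index_subgroup subgroup.subset by blast

text \<open>Counting by colours: one representative is fixed per colour, and equal colours force
  equal cosets, so each coset is that of some representative and there are no more cosets than
  colours.\<close>

lemma finite_indexI: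
  assumes H: "subgroup H G" and fin: "finite (\<kappa> ` carrier G)"
    and eq: "\<And>g h. g \<in> carrier G \<Longrightarrow> h \<in> carrier G \<Longrightarrow> \<kappa> g = \<kappa> h \<Longrightarrow> g \<otimes> inv h \<in> H"
  shows "finite_index G H"
proof -
  define rep where "rep k = (SOME g. g \<in> carrier G \<and> \<kappa> g = k)" for k
  have "H #> g = H #> rep (\<kappa> g)" if g: "g \<in> carrier G" for g
  proof -
    have "rep (\<kappa> g) \<in> carrier G \<and> \<kappa> (rep (\<kappa> g)) = \<kappa> g"
      unfolding rep_def by (rule someI_ex) (use g in blast)
    then have r: "rep (\<kappa> g) \<in> carrier G" "g \<otimes> inv rep (\<kappa> g) \<in> H"
      using eq[OF g] by simp_all
    then have "H #> (g \<otimes> inv rep (\<kappa> g)) = H"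
      by (intro coset_join2[OF _ H]) (auto simp: g)
    then show ?thesis
      using coset_mult_inv1 g r(1) subgroup.subset[OF H] by blast
  qed
  then have "rcosets H \<subseteq> (\<lambda>k. H #> rep k) ` \<kappa> ` carrier G"
    unfolding RCOSETS_def by blast
  then have "finite (rcosets H)"
    using fin finite_subset by blast
  with H show ?thesis by (simp add: finite_index_def)
qed

lemma same_rcoset_imp:
  assumes H: "subgroup H G" and "g \<in> carrier G" "h \<in> carrier G" "H #> g = H #> h"
  shows "g \<otimes> inv h \<in> H"
proof (rule coset_join1[OF _ _ H])
  show "H #> (g \<otimes> inv h) = H"
    using assms by (intro coset_mult_inv2) (auto dest: subgroup.subset)
qed (use assms in simp)

lemma finite_image_rcos:
  assumes "finite_index G H" shows "finite ((\<lambda>g. H #> g) ` carrier G)"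
proof -
  have "(\<lambda>g. H #> g) ` carrier G = rcosets H"
    by (auto simp: RCOSETS_def)
  then show ?thesis
    by (simp add: assms finite_index_rcosets)
qed

lemma finite_index_carrier: "finite_index G (carrier G)"
  by (rule finite_indexI[where \<kappa> = "\<lambda>_. ()"]) (auto simp: subgroup_self)

text \<open>The colour of \<open>g\<close> is its pair of cosets; two elements with the same pair
  differ by an element of both subgroups.\<close>

lemma finite_index_Int:
  assumes A: "finite_index G A" and B: "finite_index G B"
  shows "finite_index G (A \<inter> B)"
proof (rule finite_indexI[where \<kappa> = "\<lambda>g. (A #> g, B #> g)"])
  note sg = finite_index_subgroup[OF A] finite_index_subgroup[OF B]
  show "subgroup (A \<inter> B) G"
    using subgroups_Inter_pair[OF sg] .
  have "(\<lambda>g. (A #> g, B #> g)) ` carrier G \<subseteq>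
      ((\<lambda>g. A #> g) ` carrier G) \<times> ((\<lambda>g. B #> g) ` carrier G)"
    by blast
  then show "finite ((\<lambda>g. (A #> g, B #> g)) ` carrier G)"
    by (rule finite_subset) (intro finite_cartesian_product finite_image_rcos A B)
  fix g h assume "g \<in> carrier G" "h \<in> carrier G" "(A #> g, B #> g) = (A #> h, B #> h)"
  then show "g \<otimes> inv h \<in> A \<inter> B"
    using same_rcoset_imp[OF sg(1)] same_rcoset_imp[OF sg(2)] by simp
qed

section \<open>Isomorphisms between finite-index subgroups\<close>

lemma partial_isos_iff:
  "(A, B, \<phi>) \<in> partial_isos G \<longleftrightarrow> finite_index G A \<and> finite_index G B \<and> bij_betw \<phi> A B \<and>
     (\<forall>x\<in>A. \<forall>y\<in>A. \<phi> (x \<otimes> y) = \<phi> x \<otimes> \<phi> y)"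
  by (auto simp: partial_isos_def iso_def hom_def dest: bij_betwE)

lemma partial_iso_inv:
  assumes p: "(A, B, \<phi>) \<in> partial_isos G" and x: "x \<in> A"
  shows "\<phi> (inv x) = inv (\<phi> x)"
proof -
  have sub: "subgroup A G" "subgroup B G" and img: "\<phi> ` A = B"
    and mult: "\<And>x y. x \<in> A \<Longrightarrow> y \<in> A \<Longrightarrow> \<phi> (x \<otimes> y) = \<phi> x \<otimes> \<phi> y"
    using p by (auto simp: partial_isos_iff finite_index_subgroup bij_betw_def)
  note A = sub(1)[THEN subgroup.m_inv_closed] sub(1)[THEN subgroup.one_closed]
    and c = sub[THEN subgroup.mem_carrier]
  have 1: "\<phi> \<one> \<in> carrier G"
    using A(2) img c(2) by blast
  have "\<phi> \<one> \<otimes> \<phi> \<one> = \<phi> \<one>"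
    using mult[of \<one> \<one>] A(2) by simp
  then have "\<phi> \<one> = \<one>"
    using 1 by (metis l_cancel_one)
  moreover have "\<phi> x \<in> carrier G" "\<phi> (inv x) \<in> carrier G"
    using A(1)[OF x] x img c(2) by blast+
  moreover have "\<phi> (inv x) \<otimes> \<phi> x = \<phi> \<one>"
    using mult[OF A(1)[OF x] x] c(1)[OF x] by simp
  ultimately show ?thesis
    by (metis inv_equality)
qed

text \<open>A coset \<open>A #> g\<close> is colored further by the coset of \<open>\<phi> (g \<otimes> inv r)\<close>, where \<open>r\<close> is a
  chosen representative.\<close>

lemma finite_index_vimage:
  assumes p: "(A, B, \<phi>) \<in> partial_isos G" and C: "finite_index G C"
  shows "finite_index G {g \<in> A. \<phi> g \<in> C}"
proof -
  have A: "finite_index G A" and B: "finite_index G B" and img: "\<phi> ` A = B"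
    and mult: "\<And>x y. x \<in> A \<Longrightarrow> y \<in> A \<Longrightarrow> \<phi> (x \<otimes> y) = \<phi> x \<otimes> \<phi> y"
    using p by (auto simp: partial_isos_iff bij_betw_def)
  note sA = finite_index_subgroup[OF A] and sB = finite_index_subgroup[OF B]
    and sC = finite_index_subgroup[OF C]
  note inv = partial_iso_inv[OF p]
  have im: "\<phi> x \<in> carrier G" if "x \<in> A" for x
    using that img subgroup.mem_carrier[OF sB] by blast
  define rep where "rep X = (SOME g. g \<in> carrier G \<and> A #> g = X)" for X
  have rep: "rep (A #> g) \<in> carrier G" "g \<otimes> inv (rep (A #> g)) \<in> A"
    if g: "g \<in> carrier G" for g
  proof -
    have *: "rep (A #> g) \<in> carrier G \<and> A #> rep (A #> g) = A #> g"
      unfolding rep_def by (rule someI_ex) (use g in blast)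
    then show "rep (A #> g) \<in> carrier G" by simp
    show "g \<otimes> inv (rep (A #> g)) \<in> A"
      using same_rcoset_imp[OF sA g] * by simp
  qed
  define \<kappa> where "\<kappa> g = (A #> g, C #> \<phi> (g \<otimes> inv (rep (A #> g))))" for g
  show ?thesis
  proof (rule finite_indexI)
    show "subgroup {g \<in> A. \<phi> g \<in> C} G"
    proof (rule subgroupI)
      show "{g \<in> A. \<phi> g \<in> C} \<subseteq> carrier G"
        using subgroup.subset[OF sA] by blast
      have "\<phi> \<one> = \<one>"
        using inv[of \<one>] mult[of \<one> "inv \<one>"] im[of \<one>] subgroup.one_closed[OF sA] by simp
      then show "{g \<in> A. \<phi> g \<in> C} \<noteq> {}"
        using subgroup.one_closed[OF sA] subgroup.one_closed[OF sC] by force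
    qed (use inv mult in \<open>auto intro: subgroup.m_inv_closed[OF sA] subgroup.m_inv_closed[OF sC]
        subgroup.m_closed[OF sA] subgroup.m_closed[OF sC]\<close>)
    have "\<kappa> ` carrier G \<subseteq> ((\<lambda>g. A #> g) ` carrier G) \<times> ((\<lambda>g. C #> g) ` carrier G)"
      unfolding \<kappa>_def using im rep by blast
    then show "finite (\<kappa> ` carrier G)"
      by (rule finite_subset) (intro finite_cartesian_product finite_image_rcos A C)
    fix g h assume g: "g \<in> carrier G" and h: "h \<in> carrier G" and eq: "\<kappa> g = \<kappa> h"
    \<comment> \<open>\<open>g\<close> and \<open>h\<close> lie in one coset of \<open>A\<close>, so
      \<open>r\<close> represents both. Cancelling it writes the quotient of \<open>g\<close> by
      \<open>h\<close> as a quotient of two elements of \<open>A\<close>, the domain of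
      \<open>\<phi>\<close>.\<close>
    define r where "r = rep (A #> g)"
    have r: "r \<in> carrier G" "g \<otimes> inv r \<in> A" "h \<otimes> inv r \<in> A"
      "C #> \<phi> (g \<otimes> inv r) = C #> \<phi> (h \<otimes> inv r)"
      using rep[OF g] rep[OF h] eq by (auto simp: r_def \<kappa>_def)
    have gh: "g \<otimes> inv h = (g \<otimes> inv r) \<otimes> inv (h \<otimes> inv r)"
    proof -
      have "inv r \<otimes> (r \<otimes> inv h) = inv h"
        using h r(1) by (simp add: m_assoc[symmetric])
      then show ?thesis
        using g h r(1) by (simp add: inv_mult_group m_assoc)
    qed
    have "\<phi> (g \<otimes> inv h) = \<phi> (g \<otimes> inv r) \<otimes> inv \<phi> (h \<otimes> inv r)"
      unfolding gh using r mult inv subgroup.m_inv_closed[OF sA] by simp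
    also have "\<dots> \<in> C"
      using same_rcoset_imp[OF sC im[OF r(2)] im[OF r(3)] r(4)] .
    finally show "g \<otimes> inv h \<in> {g \<in> A. \<phi> g \<in> C}"
      unfolding gh using r subgroup.m_inv_closed[OF sA] subgroup.m_closed[OF sA] by simp
  qed
qed

lemma partial_iso_inverse:
  assumes p: "(A, B, \<phi>) \<in> partial_isos G"
  shows "(B, A, inv_into A \<phi>) \<in> partial_isos G"
proof -
  have A: "subgroup A G" and bij: "bij_betw \<phi> A B"
    and mult: "\<And>x y. x \<in> A \<Longrightarrow> y \<in> A \<Longrightarrow> \<phi> (x \<otimes> y) = \<phi> x \<otimes> \<phi> y"
    using p by (auto simp: partial_isos_iff finite_index_subgroup)
  have "inv_into A \<phi> (x \<otimes> y) = inv_into A \<phi> x \<otimes> inv_into A \<phi> y" if "x \<in> B" "y \<in> B" for x y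
  proof -
    have "x \<in> \<phi> ` A" "y \<in> \<phi> ` A"
      using that bij by (simp_all add: bij_betw_def)
    then obtain a b where ab: "a \<in> A" "b \<in> A" "x = \<phi> a" "y = \<phi> b"
      by blast
    then have "x \<otimes> y = \<phi> (a \<otimes> b)" "a \<otimes> b \<in> A"
      using mult subgroup.m_closed[OF A] by auto
    then show ?thesis
      using ab bij by (simp add: bij_betw_def)
  qed
  then show ?thesis
    using p bij_betw_inv_into[OF bij] by (simp add: partial_isos_iff)
qed

text \<open>The image of \<open>A \<inter> C\<close> is the preimage of \<open>C\<close> under the
  inverse partial isomorphism, so the result on preimages applies.\<close>

lemma finite_index_image:
  assumes p: "(A, B, \<phi>) \<in> partial_isos G" and C: "finite_index G C"
  shows "finite_index G (\<phi> ` (A \<inter> C))"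
proof -
  have bij: "bij_betw \<phi> A B"
    using p by (simp add: partial_isos_iff)
  have "\<phi> ` (A \<inter> C) = {h \<in> B. inv_into A \<phi> h \<in> C}"
  proof
    show "\<phi> ` (A \<inter> C) \<subseteq> {h \<in> B. inv_into A \<phi> h \<in> C}"
      using bij by (auto simp: bij_betw_def)
    show "{h \<in> B. inv_into A \<phi> h \<in> C} \<subseteq> \<phi> ` (A \<inter> C)"
      using bij by (force simp: bij_betw_def)
  qed
  then show ?thesis
    using finite_index_vimage[OF partial_iso_inverse[OF p] C] by simp
qed

text \<open>The domain of the composite is a preimage under the inner map and its range an image
  under the outer one; both have finite index.\<close>

lemma partial_comp_closed:
  assumes x: "x \<in> partial_isos G" and y: "y \<in> partial_isos G"
  shows "partial_comp x y \<in> partial_isos G"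
proof -
  obtain A B \<phi> A' B' \<phi>' where xy: "x = (A, B, \<phi>)" "y = (A', B', \<phi>')"
    by (metis prod_cases3)
  have "finite_index G {g \<in> A'. \<phi>' g \<in> A}" "finite_index G (\<phi> ` (A \<inter> B'))"
    using finite_index_vimage[of A' B' \<phi>' A] finite_index_image[of A B \<phi> B'] x y
    by (auto simp: xy partial_isos_iff)
  moreover have "bij_betw (\<phi> \<circ> \<phi>') {g \<in> A'. \<phi>' g \<in> A} (\<phi> ` (A \<inter> B'))"
  proof (rule bij_betw_trans)
    show "bij_betw \<phi>' {g \<in> A'. \<phi>' g \<in> A} (A \<inter> B')"
      using y by (auto simp: xy partial_isos_iff bij_betw_def intro: inj_on_subset)
    show "bij_betw \<phi> (A \<inter> B') (\<phi> ` (A \<inter> B'))"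
      using x by (auto simp: xy partial_isos_iff bij_betw_def intro: inj_on_subset)
  qed
  ultimately show ?thesis
    using x y by (simp add: xy partial_isos_iff)
qed

lemma comm_relI:
  assumes "(A, B, \<phi>) \<in> partial_isos G" "(A', B', \<phi>') \<in> partial_isos G"
    "finite_index G C" "C \<subseteq> A" "C \<subseteq> A'" "\<And>g. g \<in> C \<Longrightarrow> \<phi> g = \<phi>' g"
  shows "((A, B, \<phi>), (A', B', \<phi>')) \<in> comm_rel G"
  using assms unfolding comm_rel_def by blast

lemma comm_relE:
  assumes "((A, B, \<phi>), (A', B', \<phi>')) \<in> comm_rel G"
  obtains C where "(A, B, \<phi>) \<in> partial_isos G" "(A', B', \<phi>') \<in> partial_isos G"
    "finite_index G C" "C \<subseteq> A" "C \<subseteq> A'" "\<forall>g\<in>C. \<phi> g = \<phi>' g"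
  using assms unfolding comm_rel_def by blast

text \<open>Transitivity rests on intersections: where both agreements hold, the outer two maps
  agree, and this subgroup still has finite index.\<close>

lemma equiv_comm_rel: "equiv (partial_isos G) (comm_rel G)"
proof (rule equivI)
  show "comm_rel G \<subseteq> partial_isos G \<times> partial_isos G"
    unfolding comm_rel_def by blast
  show "refl_on (partial_isos G) (comm_rel G)"
    unfolding refl_on_def
  proof (intro ballI)
    fix x assume x: "x \<in> partial_isos G"
    then show "(x, x) \<in> comm_rel G"
      by (cases x) (auto simp: partial_isos_iff intro: comm_relI)
  qed
  show "sym (comm_rel G)"
  proof (rule symI)
    fix x y assume xy: "(x, y) \<in> comm_rel G"
    obtain A B \<phi> A' B' \<phi>' where e: "x = (A, B, \<phi>)" "y = (A', B', \<phi>')"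
      by (metis prod_cases3)
    show "(y, x) \<in> comm_rel G"
      using xy unfolding e by (elim comm_relE) (rule comm_relI, auto)
  qed
  show "trans (comm_rel G)"
  proof (rule transI)
    fix x y z assume xy: "(x, y) \<in> comm_rel G" and yz: "(y, z) \<in> comm_rel G"
    obtain A B \<phi> A' B' \<phi>' A'' B'' \<phi>''
      where e: "x = (A, B, \<phi>)" "y = (A', B', \<phi>')" "z = (A'', B'', \<phi>'')"
      by (metis prod_cases3)
    obtain C where C: "x \<in> partial_isos G" "finite_index G C" "C \<subseteq> A" "C \<subseteq> A'"
      "\<forall>g\<in>C. \<phi> g = \<phi>' g"
      using xy unfolding e by (elim comm_relE) blast
    obtain D where D: "z \<in> partial_isos G" "finite_index G D" "D \<subseteq> A'" "D \<subseteq> A''"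
      "\<forall>g\<in>D. \<phi>' g = \<phi>'' g"
      using yz unfolding e by (elim comm_relE) blast
    show "(x, z) \<in> comm_rel G"
      unfolding e
      by (rule comm_relI[OF C(1)[unfolded e] D(1)[unfolded e] finite_index_Int[OF C(2) D(2)]])
        (use C D in auto)
  qed
qed

text \<open>The composites agree on those elements of \<open>D\<close>, where the inner maps agree,
  that \<open>\<psi>\<close> sends into \<open>C\<close>, where the outer maps agree. This makes
  composition of classes well defined.\<close>

lemma partial_comp_cong:
  assumes x: "(x, x') \<in> comm_rel G" and y: "(y, y') \<in> comm_rel G"
  shows "(partial_comp x y, partial_comp x' y') \<in> comm_rel G"
proof -
  obtain A B \<phi> A' B' \<phi>' where e: "x = (A, B, \<phi>)" "x' = (A', B', \<phi>')"
    by (metis prod_cases3)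
  obtain K L \<psi> K' L' \<psi>' where f: "y = (K, L, \<psi>)" "y' = (K', L', \<psi>')"
    by (metis prod_cases3)
  obtain C where C: "x \<in> partial_isos G" "x' \<in> partial_isos G" "finite_index G C" "C \<subseteq> A"
    "C \<subseteq> A'" "\<forall>g\<in>C. \<phi> g = \<phi>' g"
    using x unfolding e by (elim comm_relE) blast
  obtain D where D: "y \<in> partial_isos G" "y' \<in> partial_isos G" "finite_index G D" "D \<subseteq> K"
    "D \<subseteq> K'" "\<forall>g\<in>D. \<psi> g = \<psi>' g"
    using y unfolding f by (elim comm_relE) blast
  have E: "finite_index G (D \<inter> {g \<in> K. \<psi> g \<in> C})"
    using finite_index_Int[OF D(3) finite_index_vimage[OF D(1)[unfolded f] C(3)]] .
  show ?thesis
    using partial_comp_closed[OF C(1) D(1)] partial_comp_closed[OF C(2) D(2)]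
    unfolding e f partial_comp.simps
    by (rule comm_relI[OF _ _ E]) (use C(4-) D(4-) in auto)
qed

section \<open>The group of commensuration classes\<close>

abbreviation comm_class :: "'a partial_iso \<Rightarrow> 'a partial_iso set" where
  "comm_class x \<equiv> comm_rel G `` {x}"

lemma abstract_commensurator_carrierE:
  assumes "c \<in> carrier (abstract_commensurator G)"
  obtains x where "x \<in> partial_isos G" "c = comm_class x"
  using assms by (auto simp: abstract_commensurator_def elim: quotientE)

lemma comm_class_carrier:
  "x \<in> partial_isos G \<Longrightarrow> comm_class x \<in> carrier (abstract_commensurator G)"
  by (simp add: abstract_commensurator_def quotientI)

lemma comm_class_eqI: "(x, y) \<in> comm_rel G \<Longrightarrow> comm_class x = comm_class y"
  using equiv_class_eq[OF equiv_comm_rel] .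

lemma comm_class_self: "x \<in> partial_isos G \<Longrightarrow> x \<in> comm_class x"
  using equiv_class_self[OF equiv_comm_rel] .

text \<open>The product is defined as a union over all pairs of representatives. By congruence every
  pair contributes the same class, and the union is nonempty, so it collapses to that class.\<close>

lemma comm_class_mult:
  assumes "x \<in> partial_isos G" "y \<in> partial_isos G"
  shows "comm_class x \<otimes>\<^bsub>abstract_commensurator G\<^esub> comm_class y = comm_class (partial_comp x y)"
proof -
  have "comm_class (partial_comp x' y') = comm_class (partial_comp x y)"
    if "x' \<in> comm_class x" "y' \<in> comm_class y" for x' y'
    using that partial_comp_cong[of x x' y y'] comm_class_eqI by auto
  then have "comm_class x \<otimes>\<^bsub>abstract_commensurator G\<^esub> comm_class y =
      (\<Union>x'\<in>comm_class x. \<Union>y'\<in>comm_class y. comm_class (partial_comp x y))"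
    by (simp add: abstract_commensurator_def)
  also have "\<dots> = comm_class (partial_comp x y)"
    using comm_class_self[OF assms(1)] comm_class_self[OF assms(2)] by blast
  finally show ?thesis .
qed

lemma mem_mult_comm_class:
  assumes c: "c \<in> carrier (abstract_commensurator G)" "d \<in> carrier (abstract_commensurator G)"
    and x: "x \<in> c" and y: "y \<in> d"
  shows "partial_comp x y \<in> c \<otimes>\<^bsub>abstract_commensurator G\<^esub> d"
proof -
  obtain x0 y0 where "x0 \<in> partial_isos G" "y0 \<in> partial_isos G"
    and cd: "c = comm_class x0" "d = comm_class y0"
    using abstract_commensurator_carrierE c by metis
  then show ?thesis
    using partial_comp_cong[of x0 x y0 y] x y by (simp add: comm_class_mult)
qed

lemma mem_comm_carrier:
  assumes "c \<in> carrier (abstract_commensurator G)" "x \<in> c"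
  shows "x \<in> partial_isos G" "c = comm_class x"
proof -
  obtain y where "c = comm_class y"
    using assms(1) by (rule abstract_commensurator_carrierE)
  then have "(y, x) \<in> comm_rel G"
    using assms by simp
  then show "x \<in> partial_isos G" "c = comm_class x"
    using \<open>c = _\<close> comm_class_eqI equiv_type[OF equiv_comm_rel] by auto
qed

lemma partial_iso_id: "(carrier G, carrier G, id) \<in> partial_isos G"
  by (simp add: partial_isos_iff finite_index_carrier)

lemma partial_comp_inverse:
  assumes p: "(A, B, \<phi>) \<in> partial_isos G"
  shows "(partial_comp (B, A, inv_into A \<phi>) (A, B, \<phi>), (carrier G, carrier G, id)) \<in> comm_rel G"
proof -
  have A: "finite_index G A" and bij: "bij_betw \<phi> A B"
    using p by (auto simp: partial_isos_iff)
  show ?thesis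
    using partial_comp_closed[OF partial_iso_inverse[OF p] p] unfolding partial_comp.simps
    by (rule comm_relI[OF _ partial_iso_id A])
      (use bij finite_index_subset[OF A] in \<open>auto simp: bij_betw_def\<close>)
qed

lemma group_abstract_commensurator: "group (abstract_commensurator G)"
proof (rule groupI)
  let ?K = "abstract_commensurator G"
  have one: "\<one>\<^bsub>?K\<^esub> = comm_class (carrier G, carrier G, id)"
    by (simp add: abstract_commensurator_def)
  show "\<one>\<^bsub>?K\<^esub> \<in> carrier ?K"
    using comm_class_carrier[OF partial_iso_id] by (simp add: one)
  fix c assume c: "c \<in> carrier ?K"
  then obtain x where x: "x \<in> partial_isos G" "c = comm_class x"
    by (rule abstract_commensurator_carrierE)
  obtain A B \<phi> where e: "x = (A, B, \<phi>)"
    by (metis prod_cases3)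
  show "\<one>\<^bsub>?K\<^esub> \<otimes>\<^bsub>?K\<^esub> c = c"
  proof -
    have "(partial_comp (carrier G, carrier G, id) x, x) \<in> comm_rel G"
      using partial_comp_closed[OF partial_iso_id x(1)] x(1) unfolding e partial_comp.simps
      by (rule comm_relI[where C = A])
        (use x(1) in \<open>auto simp: e partial_isos_iff bij_betw_def dest!: finite_index_subset\<close>)
    then show ?thesis
      by (simp add: one x comm_class_mult partial_iso_id comm_class_eqI)
  qed
  show "\<exists>d\<in>carrier ?K. d \<otimes>\<^bsub>?K\<^esub> c = \<one>\<^bsub>?K\<^esub>"
    using partial_iso_inverse[of A B \<phi>] partial_comp_inverse[of A B \<phi>] x
    by (intro bexI[of _ "comm_class (B, A, inv_into A \<phi>)"])
      (simp_all only: e one comm_class_mult comm_class_eqI comm_class_carrier)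
  fix d assume d: "d \<in> carrier ?K"
  then obtain y where y: "y \<in> partial_isos G" "d = comm_class y"
    by (rule abstract_commensurator_carrierE)
  show "c \<otimes>\<^bsub>?K\<^esub> d \<in> carrier ?K"
    by (simp add: x y comm_class_mult partial_comp_closed comm_class_carrier)
  fix e assume "e \<in> carrier ?K"
  then obtain z where z: "z \<in> partial_isos G" "e = comm_class z"
    by (rule abstract_commensurator_carrierE)
  have "partial_comp (partial_comp x y) z = partial_comp x (partial_comp y z)"
    using x y z by (cases x; cases y; cases z) (auto simp: partial_isos_iff bij_betw_def)
  then show "c \<otimes>\<^bsub>?K\<^esub> d \<otimes>\<^bsub>?K\<^esub> e = c \<otimes>\<^bsub>?K\<^esub> (d \<otimes>\<^bsub>?K\<^esub> e)"
    by (simp add: x y z comm_class_mult partial_comp_closed)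
qed

lemma inverse_mem_inv:
  assumes c: "c \<in> carrier (abstract_commensurator G)" and x: "(A, B, \<phi>) \<in> c"
  shows "(B, A, inv_into A \<phi>) \<in> inv\<^bsub>abstract_commensurator G\<^esub> c"
proof -
  let ?K = "abstract_commensurator G" and ?y = "(B, A, inv_into A \<phi>)"
  have p: "(A, B, \<phi>) \<in> partial_isos G" and ce: "c = comm_class (A, B, \<phi>)"
    using mem_comm_carrier[OF c x] by auto
  note y = partial_iso_inverse[OF p]
  have "comm_class ?y \<otimes>\<^bsub>?K\<^esub> c = comm_class (carrier G, carrier G, id)"
    unfolding ce comm_class_mult[OF y p] by (rule comm_class_eqI[OF partial_comp_inverse[OF p]])
  then have "inv\<^bsub>?K\<^esub> c = comm_class ?y"
    using group.inv_equality[OF group_abstract_commensurator _ c comm_class_carrier[OF y]]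
    by (simp add: abstract_commensurator_def)
  then show ?thesis
    using comm_class_self[OF y] by simp
qed

lemma id_mem_one: "(carrier G, carrier G, id) \<in> \<one>\<^bsub>abstract_commensurator G\<^esub>"
  using comm_class_self[OF partial_iso_id] by (simp add: abstract_commensurator_def)

end

section \<open>Dyadic piecewise linear homeomorphisms\<close>

lemma dyadics_of_int: "of_int a \<in> dyadics"
  unfolding dyadics_def by (rule CollectI, intro exI[of _ a] exI[of _ "0::nat"]) simp

lemma dyadics_add:
  assumes "x \<in> dyadics" "y \<in> dyadics" shows "x + y \<in> dyadics"
proof -
  obtain a m b n where "x = of_int a / 2 ^ m" "y = of_int b / 2 ^ n"
    using assms unfolding dyadics_def by blast
  then have "x + y = of_int (a * 2 ^ n + b * 2 ^ m) / 2 ^ (m + n)"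
    by (simp add: power_add add_divide_distrib)
  then show ?thesis
    unfolding dyadics_def by blast
qed

lemma dyadics_mult:
  assumes "x \<in> dyadics" "y \<in> dyadics" shows "x * y \<in> dyadics"
proof -
  obtain a m b n where "x = of_int a / 2 ^ m" "y = of_int b / 2 ^ n"
    using assms unfolding dyadics_def by blast
  then have "x * y = of_int (a * b) / 2 ^ (m + n)"
    by (simp add: power_add)
  then show ?thesis
    unfolding dyadics_def by blast
qed

lemma dyadics_diff:
  assumes "x \<in> dyadics" "y \<in> dyadics" shows "x - y \<in> dyadics"
  using dyadics_add[OF assms(1) dyadics_mult[OF dyadics_of_int[of "-1"] assms(2)]] by simp

lemma dyadics_powi: "2 powi k \<in> dyadics"
proof (cases "k \<ge> 0")
  case True
  then show ?thesis
    using dyadics_of_int[of "2 ^ nat k"] by (simp add: power_int_def)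
next
  case False
  then have "(2::real) powi k = of_int 1 / 2 ^ nat (- k)"
    by (simp add: power_int_def power_inverse inverse_eq_divide power_one_over)
  then show ?thesis
    unfolding dyadics_def by blast
qed

lemma dyadics_dense:
  assumes "a < b" shows "\<exists>z\<in>dyadics. a < z \<and> z < b"
proof -
  obtain n where "(1/2) ^ n < b - a"
    using real_arch_pow_inv[of "b - a" "1/2"] assms by auto
  then have n: "1 / 2 ^ n < b - a"
    by (simp add: power_one_over)
  \<comment> \<open>The least multiple of \<open>1 / 2 ^ n\<close> strictly above \<open>a\<close>:
    adding 1 to the floor keeps the inequality strict when \<open>a\<close> is itself such a
    multiple.\<close>
  define z where "z = of_int (\<lfloor>a * 2 ^ n\<rfloor> + 1) / (2::real) ^ n"
  have "a * 2 ^ n < of_int (\<lfloor>a * 2 ^ n\<rfloor> + 1)" "of_int (\<lfloor>a * 2 ^ n\<rfloor> + 1) \<le> a * 2 ^ n + 1"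
    by linarith+
  then have "a < z" "z \<le> a + 1 / 2 ^ n"
    by (auto simp: z_def field_simps)
  then show ?thesis
    using n unfolding z_def dyadics_def by (intro bexI[of _ z]) (auto simp: z_def simp del: of_int_add)
qed

section \<open>Slopes and affine germs\<close>

definition dyadic_slope :: "real \<Rightarrow> bool" where
  "dyadic_slope m \<longleftrightarrow> (\<exists>k::int. \<bar>m\<bar> = 2 powi k)"

lemma dyadic_slope_powi: "dyadic_slope (2 powi k)"
  unfolding dyadic_slope_def by (rule exI[of _ k]) simp

lemma dyadic_slope_nonzero: "dyadic_slope m \<Longrightarrow> m \<noteq> 0"
  by (auto simp: dyadic_slope_def)

lemma dyadic_slope_mult:
  assumes "dyadic_slope m" "dyadic_slope n" shows "dyadic_slope (m * n)"
proof -
  obtain k l :: int where "\<bar>m\<bar> = 2 powi k" "\<bar>n\<bar> = 2 powi l"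
    using assms unfolding dyadic_slope_def by blast
  then have "\<bar>m * n\<bar> = 2 powi (k + l)"
    by (simp add: abs_mult power_int_add)
  then show ?thesis
    unfolding dyadic_slope_def by blast
qed

lemma dyadic_slope_inverse:
  assumes "dyadic_slope m" shows "dyadic_slope (1 / m)"
proof -
  obtain k :: int where "\<bar>m\<bar> = 2 powi k"
    using assms unfolding dyadic_slope_def by blast
  then have "\<bar>1 / m\<bar> = 2 powi (- k)"
    by (simp add: power_int_minus divide_inverse)
  then show ?thesis
    unfolding dyadic_slope_def by blast
qed

lemma dyadic_slope_dyadics:
  assumes "dyadic_slope m" shows "m \<in> dyadics"
proof -
  obtain k :: int where "\<bar>m\<bar> = 2 powi k"
    using assms unfolding dyadic_slope_def by blast
  then have "m = 2 powi k \<or> m = of_int (-1) * 2 powi k"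
    by auto
  then show ?thesis
    using dyadics_powi dyadics_mult[OF dyadics_of_int dyadics_powi] by metis
qed

text \<open>Being affine with slope \<open>m\<close> is an open condition: an open set on which the
  formula holds is a neighbourhood of each of its points.\<close>

lemma affine_near_eventually:
  "affine_near f m x \<Longrightarrow> \<forall>\<^sub>F y in nhds x. affine_near f m y"
  unfolding affine_near_def by (subst (asm) eventually_eventually[symmetric])
    (auto elim: eventually_mono)

lemma affine_near_DERIV:
  assumes "affine_near f m x" shows "DERIV f x :> m"
proof -
  obtain c where "\<forall>\<^sub>F y in nhds x. f y = m * y + c"
    using assms unfolding affine_near_def by blast
  then show ?thesis
    by (subst DERIV_cong_ev[OF refl _ refl]) (auto intro!: derivative_eq_intros)
qed

lemma affine_near_unique: "affine_near f m x \<Longrightarrow> affine_near f n x \<Longrightarrow> m = n"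
  using affine_near_DERIV DERIV_unique by blast

lemma affine_near_comp:
  assumes g: "affine_near g m x" and f: "affine_near f n (g x)"
  shows "affine_near (f \<circ> g) (n * m) x"
proof -
  obtain c d where c: "\<forall>\<^sub>F y in nhds x. g y = m * y + c"
    and d: "\<forall>\<^sub>F y in nhds (g x). f y = n * y + d"
    using f g unfolding affine_near_def by blast
  have "filterlim g (nhds (g x)) (nhds x)"
    using DERIV_isCont[OF affine_near_DERIV[OF g]] by (simp add: continuous_at tendsto_nhds_iff)
  then have "\<forall>\<^sub>F y in nhds x. f (g y) = n * g y + d"
    using eventually_compose_filterlim[OF d] by blast
  with c have "\<forall>\<^sub>F y in nhds x. (f \<circ> g) y = (n * m) * y + (n * c + d)"
    by eventually_elim (simp add: algebra_simps)
  then show ?thesis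
    unfolding affine_near_def by blast
qed

lemma affine_near_inverse:
  assumes f: "affine_near f m x" and m: "m \<noteq> 0" and h: "homeomorphism UNIV UNIV f g"
  shows "affine_near g (1 / m) (f x)"
proof -
  obtain c where c: "\<forall>\<^sub>F y in nhds x. f y = m * y + c"
    using f unfolding affine_near_def by blast
  have fg: "g (f x) = x" "f (g y) = y" for x y
    using h by (auto simp: homeomorphism_def)
  have "isCont g (f x)"
    using h by (simp add: homeomorphism_def continuous_on_eq_continuous_at)
  then have "filterlim g (nhds x) (nhds (f x))"
    using fg by (simp add: continuous_at tendsto_nhds_iff)
  then have "\<forall>\<^sub>F y in nhds (f x). f (g y) = m * g y + c"
    using eventually_compose_filterlim[OF c] by blast
  then have "\<forall>\<^sub>F y in nhds (f x). g y = (1 / m) * y + (- c / m)"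
    by eventually_elim (use m fg in \<open>simp add: field_simps\<close>)
  then show ?thesis
    unfolding affine_near_def by blast
qed

section \<open>Locally finite sets\<close>

text \<open>The condition on breakpoints is isolated for arbitrary sets so that a superset of the
  breakpoints can stand in for them.\<close>

definition locally_finite_set :: "real set \<Rightarrow> bool" where
  "locally_finite_set S \<longleftrightarrow> (\<forall>a b. finite (S \<inter> {a..b}))"

lemma locally_finite_set_Un:
  "locally_finite_set S \<Longrightarrow> locally_finite_set T \<Longrightarrow> locally_finite_set (S \<union> T)"
  by (simp add: locally_finite_set_def Int_Un_distrib2)

text \<open>Within distance 1 of \<open>x\<close> only finitely many points of \<open>S\<close>
  other than \<open>x\<close> occur; deleting them leaves an open neighbourhood of
  \<open>x\<close>.\<close>

lemma locally_finite_set_eventually: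
  assumes "locally_finite_set S" shows "\<forall>\<^sub>F y in at x. y \<notin> S"
proof -
  define U where "U = {x - 1<..<x + 1} - ((S \<inter> {x - 1..x + 1}) - {x})"
  have "finite ((S \<inter> {x - 1..x + 1}) - {x})"
    using assms by (simp add: locally_finite_set_def)
  then have "open U"
    unfolding U_def by (intro open_Diff open_greaterThanLessThan finite_imp_closed)
  moreover have "x \<in> U" "\<forall>y\<in>U. y \<noteq> x \<longrightarrow> y \<notin> S"
    by (auto simp: U_def)
  ultimately show ?thesis
    unfolding eventually_at_topological by blast
qed

text \<open>A segment has bounded image, which meets \<open>S\<close> in finitely many points;
  injectivity gives each of these at most one preimage.\<close>

lemma locally_finite_set_vimage:
  assumes S: "locally_finite_set S" and f: "continuous_on UNIV f" and inj: "inj f"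
  shows "locally_finite_set (f -` S)"
  unfolding locally_finite_set_def
proof (intro allI)
  fix a b :: real
  have "bounded (f ` {a..b})"
    using f by (intro compact_imp_bounded compact_continuous_image) (auto intro: continuous_on_subset)
  then obtain r where "\<forall>x\<in>f ` {a..b}. \<bar>x\<bar> \<le> r"
    unfolding bounded_real by blast
  then have "f -` S \<inter> {a..b} \<subseteq> f -` (S \<inter> {- r..r})"
    by (auto simp: abs_le_iff minus_le_iff)
  moreover have "finite (f -` (S \<inter> {- r..r}))"
    using S inj by (intro finite_vimageI) (auto simp: locally_finite_set_def)
  ultimately show "finite (f -` S \<inter> {a..b})"
    using finite_subset by blast
qed

section \<open>Closure of \<open>PL2\<close> under composition and inversion\<close>

lemma PL2_homeomorphism:
  assumes "f \<in> PL2" shows "homeomorphism UNIV UNIV f (inv_into UNIV f)"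
proof -
  obtain g where g: "homeomorphism UNIV UNIV f g"
    using assms unfolding PL2_def by blast
  then have "inv_into UNIV f = g"
    by (intro inv_equality) (auto simp: homeomorphism_def)
  with g show ?thesis by simp
qed

lemma PL2_bij: "f \<in> PL2 \<Longrightarrow> bij f"
  using PL2_homeomorphism[of f]
  by (metis bij_betw_def homeomorphism_def inj_on_inverseI)

lemma PL2_breakpoints:
  assumes "f \<in> PL2"
  shows "locally_finite_set (breakpoints f)" "breakpoints f \<subseteq> dyadics"
  using assms by (auto simp: PL2_def locally_finite_set_def)

lemma PL2_dyadics: "f \<in> PL2 \<Longrightarrow> x \<in> dyadics \<Longrightarrow> f x \<in> dyadics"
  by (auto simp: PL2_def)

lemma PL2_slope: "f \<in> PL2 \<Longrightarrow> affine_near f m x \<Longrightarrow> dyadic_slope m"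
  by (auto simp: PL2_def dyadic_slope_def)

lemma PL2_affine_near:
  assumes "f \<in> PL2" "x \<notin> breakpoints f"
  obtains m where "dyadic_slope m" "affine_near f m x"
  using assms PL2_slope unfolding breakpoints_def by blast

text \<open>Here \<open>S\<close> may be larger than the set of breakpoints. If \<open>f\<close> is
  affine near a point of \<open>S\<close>, its slope there is also the slope at nearby points
  outside \<open>S\<close>, so it is still a power of two up to sign.\<close>

lemma PL2I:
  assumes h: "homeomorphism UNIV UNIV f g"
    and S: "locally_finite_set S" "S \<subseteq> dyadics"
    and slope: "\<And>x. x \<notin> S \<Longrightarrow> \<exists>m. dyadic_slope m \<and> affine_near f m x"
    and dy: "\<And>x. x \<in> dyadics \<Longrightarrow> f x \<in> dyadics"
  shows "f \<in> PL2"
proof -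
  have sub: "breakpoints f \<subseteq> S"
    using slope unfolding breakpoints_def by blast
  have "\<exists>k::int. \<bar>m\<bar> = 2 powi k" if m: "affine_near f m x" for m x
  proof -
    have "\<forall>\<^sub>F y in at x. affine_near f m y"
      using affine_near_eventually[OF m] eventually_nhds_conv_at by blast
    with locally_finite_set_eventually[OF S(1)]
    have "\<forall>\<^sub>F y in at x. y \<notin> S \<and> affine_near f m y"
      by eventually_elim simp
    then obtain y where "y \<notin> S" "affine_near f m y"
      using eventually_happens[of _ "at x"] by auto
    then show ?thesis
      using slope affine_near_unique unfolding dyadic_slope_def by metis
  qed
  moreover have "finite (breakpoints f \<inter> {a..b})" for a b
    using S(1) sub unfolding locally_finite_set_def by (meson Int_mono finite_subset order_refl)
  ultimately show ?thesis
    using h S(2) sub dy unfolding PL2_def by blast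
qed

text \<open>\<open>PL2\<close> demands only that dyadics go to dyadics; this is the converse.
  Breakpoints are dyadic, and at any other \<open>x\<close> the affine formula at a nearby dyadic
  \<open>z\<close> is solved for \<open>x\<close>, the factor \<open>1 / m\<close> being
  dyadic.\<close>

lemma PL2_inv_dyadics:
  assumes f: "f \<in> PL2" and x: "f x \<in> dyadics"
  shows "x \<in> dyadics"
proof (cases "x \<in> breakpoints f")
  case True
  then show ?thesis
    using PL2_breakpoints[OF f] by blast
next
  case False
  then obtain m where m: "dyadic_slope m" "affine_near f m x"
    using PL2_affine_near[OF f] by blast
  then obtain c where "\<forall>\<^sub>F y in nhds x. f y = m * y + c"
    unfolding affine_near_def by blast
  then obtain e where e: "e > 0" "\<And>y. dist y x < e \<Longrightarrow> f y = m * y + c"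
    unfolding eventually_nhds_metric by blast
  obtain z where z: "z \<in> dyadics" "x < z" "z < x + e"
    using dyadics_dense[of x "x + e"] e(1) by auto
  have "f z = m * z + c" "f x = m * x + c"
    using e z by (auto simp: dist_real_def)
  then have "x = z - (1 / m) * (f z - f x)"
    using dyadic_slope_nonzero[OF m(1)] by (simp add: field_simps)
  moreover have "z - (1 / m) * (f z - f x) \<in> dyadics"
    using z(1) x PL2_dyadics[OF f] dyadic_slope_dyadics[OF dyadic_slope_inverse[OF m(1)]]
    by (intro dyadics_diff dyadics_mult)
  ultimately show ?thesis by simp
qed

text \<open>The composite can break only where \<open>g\<close> does or where \<open>g\<close> hits
  a breakpoint of \<open>f\<close>; points of the second kind are dyadic by
  \<open>PL2_inv_dyadics\<close>.\<close>

lemma PL2_comp: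
  assumes f: "f \<in> PL2" and g: "g \<in> PL2" shows "f \<circ> g \<in> PL2"
proof (rule PL2I)
  show "homeomorphism UNIV UNIV (f \<circ> g) (inv_into UNIV g \<circ> inv_into UNIV f)"
    using PL2_homeomorphism[OF g] PL2_homeomorphism[OF f] by (rule homeomorphism_compose)
  have "continuous_on UNIV g" "inj g"
    using PL2_homeomorphism[OF g] PL2_bij[OF g] by (auto simp: homeomorphism_def bij_def)
  then show "locally_finite_set (breakpoints g \<union> g -` breakpoints f)"
    by (intro locally_finite_set_Un locally_finite_set_vimage PL2_breakpoints f g)
  show "breakpoints g \<union> g -` breakpoints f \<subseteq> dyadics"
    using PL2_breakpoints(2)[OF g] PL2_breakpoints(2)[OF f] PL2_inv_dyadics[OF g] by blast
  fix x
  show "\<exists>m. dyadic_slope m \<and> affine_near (f \<circ> g) m x"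
    if x: "x \<notin> breakpoints g \<union> g -` breakpoints f"
  proof -
    obtain m where m: "dyadic_slope m" "affine_near g m x"
      using PL2_affine_near[OF g, of x] x by blast
    obtain n where n: "dyadic_slope n" "affine_near f n (g x)"
      using PL2_affine_near[OF f, of "g x"] x by blast
    show ?thesis
      using dyadic_slope_mult[OF n(1) m(1)] affine_near_comp[OF m(2) n(2)] by blast
  qed
  show "(f \<circ> g) x \<in> dyadics" if "x \<in> dyadics"
    using that PL2_dyadics f g by simp
qed

lemma PL2_inv:
  assumes f: "f \<in> PL2" shows "inv_into UNIV f \<in> PL2"
proof (rule PL2I)
  let ?g = "inv_into UNIV f"
  note h = PL2_homeomorphism[OF f]
  have fg: "f (?g y) = y" for y
    using h by (simp add: homeomorphism_def)
  show "homeomorphism UNIV UNIV ?g f"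
    using h by (rule homeomorphism_symD)
  have "continuous_on UNIV ?g" "inj ?g"
    using h fg by (auto simp: homeomorphism_def intro: inj_on_inverseI)
  then show "locally_finite_set (?g -` breakpoints f)"
    by (intro locally_finite_set_vimage PL2_breakpoints f)
  show "?g -` breakpoints f \<subseteq> dyadics"
    using PL2_breakpoints(2)[OF f] PL2_dyadics[OF f] fg by (metis subsetD subsetI vimageD)
  fix x
  show "\<exists>m. dyadic_slope m \<and> affine_near ?g m x" if "x \<notin> ?g -` breakpoints f"
  proof -
    obtain m where "dyadic_slope m" "affine_near f m (?g x)"
      using \<open>x \<notin> _\<close> PL2_affine_near[OF f, of "?g x"] by blast
    then show ?thesis
      using affine_near_inverse[OF _ _ h, of m "?g x"] fg dyadic_slope_nonzero dyadic_slope_inverse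
      by metis
  qed
  show "?g x \<in> dyadics" if "x \<in> dyadics"
    using PL2_inv_dyadics[OF f, of "?g x"] that fg by simp
qed

text \<open>A monotone map of the line with open image is continuous; this applies to
  \<open>f\<close> and to its inverse, both onto.\<close>

lemma strict_mono_surj_homeomorphism:
  fixes f :: "real \<Rightarrow> real"
  assumes f: "strict_mono f" "surj f"
  shows "homeomorphism UNIV UNIV f (inv_into UNIV f)"
proof -
  have bij: "bij f"
    using f strict_mono_on_imp_inj_on by (auto simp: bij_def)
  have mono: "inv_into UNIV f x \<le> inv_into UNIV f y" if "x \<le> y" for x y
    using that f by (metis strict_mono_less_eq surj_f_inv_f)
  have "continuous_on UNIV f"
    using f by (intro continuous_onI_mono) (auto simp: strict_mono_less_eq)
  moreover have "continuous_on UNIV (inv_into UNIV f)"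
    using bij_imp_bij_inv[OF bij] mono by (intro continuous_onI_mono) (auto simp: bij_def)
  ultimately show ?thesis
    using bij by (auto simp: homeomorphism_def bij_def surj_f_inv_f inj_imp_surj_inv)
qed

lemma PL2_translation: "(\<lambda>t. t + of_int n) \<in> PL2"
proof (rule PL2I)
  show "homeomorphism UNIV UNIV (\<lambda>t. t + of_int n) (\<lambda>t. t - real_of_int n)"
    by (auto simp: homeomorphism_def intro!: continuous_intros)
  show "locally_finite_set {}"
    by (simp add: locally_finite_set_def)
  have "affine_near (\<lambda>t. t + of_int n) (2 powi 0) x" for x
    unfolding affine_near_def by (intro exI[of _ "of_int n"]) simp
  then show "\<exists>m. dyadic_slope m \<and> affine_near (\<lambda>t. t + of_int n) m x" for x
    using dyadic_slope_powi by blast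
qed (auto intro: dyadics_add dyadics_of_int)

section \<open>Behaviour near the ends of the line\<close>

text \<open>An end of the line is encoded as a filter, so that each fact about behaviour near plus
  or minus infinity is proved once for both, with no explicit cut-off.\<close>

definition is_end :: "real filter \<Rightarrow> bool" where
  "is_end F \<longleftrightarrow> F = at_top \<or> F = at_bot"

definition translates :: "real filter \<Rightarrow> (real \<Rightarrow> real) \<Rightarrow> int \<Rightarrow> bool" where
  "translates F f r \<longleftrightarrow> (\<forall>\<^sub>F t in F. f t = t + of_int r)"

definition periodic_affine :: "real filter \<Rightarrow> (real \<Rightarrow> real) \<Rightarrow> int \<Rightarrow> int \<Rightarrow> bool" where
  "periodic_affine F f p q \<longleftrightarrow> (\<forall>\<^sub>F t in F. f (t + of_int p) = f t + of_int q)"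

lemma is_end_at_top: "is_end at_top" and is_end_at_bot: "is_end at_bot"
  by (simp_all add: is_end_def)

lemma eventually_end_ex:
  assumes "is_end F" "eventually P F" shows "\<exists>t. P t"
proof -
  have "F \<noteq> bot"
    using assms(1) trivial_limit_at_top_linorder trivial_limit_at_bot_linorder
    unfolding is_end_def by metis
  then show ?thesis
    using assms(2) eventually_happens by blast
qed

text \<open>By surjectivity any bound \<open>z\<close> equals some \<open>f u\<close>, so that
  comparing \<open>f t\<close> with \<open>z\<close> amounts to comparing \<open>t\<close> with
  \<open>u\<close>.\<close>

lemma filterlim_end:
  assumes F: "is_end F" and f: "strict_mono f" "surj f"
  shows "filterlim f F F"
proof -
  have mono: "f x \<le> f y \<longleftrightarrow> x \<le> y" for x y
    using f(1) by (rule strict_mono_less_eq)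
  have "\<forall>\<^sub>F t in at_top. z \<le> f t" "\<forall>\<^sub>F t in at_bot. f t \<le> z" for z
  proof -
    obtain u where "z = f u"
      using f(2) by (rule surjE)
    then show "\<forall>\<^sub>F t in at_top. z \<le> f t" "\<forall>\<^sub>F t in at_bot. f t \<le> z"
      by (simp_all add: mono eventually_ge_at_top eventually_le_at_bot)
  qed
  then show ?thesis
    using F by (auto simp: is_end_def filterlim_at_top filterlim_at_bot)
qed

lemma filterlim_end_shift:
  assumes F: "is_end F" shows "filterlim (\<lambda>t. t + c) F F"
proof -
  have "surj (\<lambda>t::real. t + c)"
    by (rule surjI[of _ "\<lambda>t. t - c"]) simp
  then show ?thesis
    by (intro filterlim_end[OF F]) (auto intro: strict_monoI)
qed

lemma translates_comp:
  assumes F: "is_end F" and f: "translates F f r" and g: "translates F g s"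
  shows "translates F (f \<circ> g) (r + s)"
proof -
  have "\<forall>\<^sub>F t in F. f (t + of_int s) = (t + of_int s) + of_int r"
    using eventually_compose_filterlim[OF f[unfolded translates_def] filterlim_end_shift[OF F]] .
  with g show ?thesis
    unfolding translates_def by eventually_elim simp
qed

lemma translates_inv:
  assumes F: "is_end F" and f: "translates F f r" and inj: "inj f"
  shows "translates F (inv_into UNIV f) (- r)"
proof -
  have "\<forall>\<^sub>F t in F. f (t + of_int (- r)) = (t + of_int (- r)) + of_int r"
    using eventually_compose_filterlim[OF f[unfolded translates_def] filterlim_end_shift[OF F]] .
  then show ?thesis
    unfolding translates_def by eventually_elim (simp add: inv_f_eq[OF inj])
qed

lemma periodic_affine_comp:
  assumes F: "is_end F" and f: "periodic_affine F f q s"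
    and g: "periodic_affine F g p q" "strict_mono g" "surj g"
  shows "periodic_affine F (f \<circ> g) p s"
proof -
  have "\<forall>\<^sub>F t in F. f (g t + of_int q) = f (g t) + of_int s"
    using eventually_compose_filterlim[OF f[unfolded periodic_affine_def] filterlim_end[OF F g(2,3)]] .
  with g(1) show ?thesis
    unfolding periodic_affine_def by eventually_elim simp
qed

lemma strict_mono_inv_real:
  fixes f :: "real \<Rightarrow> real"
  assumes "strict_mono f" "bij f" shows "strict_mono (inv_into UNIV f)"
  using assms by (metis bij_inv_eq_iff strict_mono_less strict_monoI)

lemma periodic_affine_inv:
  assumes F: "is_end F" and f: "periodic_affine F f p q" "strict_mono f" "bij f"
  shows "periodic_affine F (inv_into UNIV f) q p"
proof -
  let ?g = "inv_into UNIV f"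
  have g: "strict_mono ?g" "surj ?g"
    using strict_mono_inv_real[OF f(2,3)] bij_imp_bij_inv[OF f(3)] by (auto simp: bij_def)
  have fg: "f (?g t) = t" "?g (f t) = t" for t
    using f(3) by (auto simp: bij_def surj_f_inv_f)
  have "\<forall>\<^sub>F t in F. f (?g t + of_int p) = f (?g t) + of_int q"
    using eventually_compose_filterlim[OF f(1)[unfolded periodic_affine_def] filterlim_end[OF F g]] .
  then show ?thesis
    unfolding periodic_affine_def
  proof eventually_elim
    case (elim t)
    then have "?g (f (?g t + of_int p)) = ?g (t + of_int q)"
      by (simp add: fg)
    then show ?case by (simp add: fg)
  qed
qed

lemma periodic_affine_uminus:
  assumes F: "is_end F" and f: "periodic_affine F f p q"
  shows "periodic_affine F f (- p) (- q)"
proof -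
  have "\<forall>\<^sub>F t in F. f (t + of_int (- p) + of_int p) = f (t + of_int (- p)) + of_int q"
    using eventually_compose_filterlim[OF f[unfolded periodic_affine_def] filterlim_end_shift[OF F]] .
  then show ?thesis
    unfolding periodic_affine_def by eventually_elim simp
qed

text \<open>The relation is iterated at shifted points, and reversed for negative \<open>k\<close>.
  Both signs occur, since elements of F may translate in either direction.\<close>

lemma periodic_affine_mult:
  assumes F: "is_end F" and f: "periodic_affine F f p q"
  shows "periodic_affine F f (k * p) (k * q)"
proof -
  have nat: "periodic_affine F f (int n * p) (int n * q)" for n
  proof (induction n)
    case 0
    then show ?case by (simp add: periodic_affine_def)
  next
    case (Suc n)
    have "\<forall>\<^sub>F t in F. f (t + of_int p + of_int (int n * p)) = f (t + of_int p) + of_int (int n * q)"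
      using eventually_compose_filterlim[OF Suc[unfolded periodic_affine_def] filterlim_end_shift[OF F]] .
    with f show ?case
      unfolding periodic_affine_def by eventually_elim (simp add: algebra_simps)
  qed
  show ?thesis
  proof (cases "k \<ge> 0")
    case True
    then show ?thesis using nat[of "nat k"] by simp
  next
    case False
    then show ?thesis using periodic_affine_uminus[OF F nat[of "nat (- k)"]] by simp
  qed
qed

text \<open>Over the common period \<open>p' * p\<close> the increment of \<open>f\<close> is both
  \<open>p' * q\<close> and \<open>p * q'\<close>. For nonzero increments this says that the ratio
  of period to increment depends only on \<open>f\<close> and the end.\<close>

lemma periodic_affine_unique:
  assumes F: "is_end F" and f: "periodic_affine F f p q" "periodic_affine F f p' q'"
  shows "p' * q = p * q'"
proof -
  have "periodic_affine F f (p' * p) (p' * q)" "periodic_affine F f (p' * p) (p * q')"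
    using periodic_affine_mult[OF F f(1), of p'] periodic_affine_mult[OF F f(2), of p]
    by (simp_all add: mult.commute)
  then have "\<forall>\<^sub>F t in F. f t + of_int (p' * q) = f t + of_int (p * q')"
    unfolding periodic_affine_def by eventually_elim simp
  then have "real_of_int (p' * q) = of_int (p * q')"
    using eventually_end_ex[OF F] by auto
  then show ?thesis
    using of_int_eq_iff by blast
qed

lemma periodic_affine_pos:
  assumes F: "is_end F" and f: "periodic_affine F f p q" "strict_mono f" and p: "p > 0"
  shows "q > 0"
proof -
  obtain t where "f (t + of_int p) = f t + of_int q"
    using eventually_end_ex[OF F f(1)[unfolded periodic_affine_def]] by blast
  moreover have "f t < f (t + of_int p)"
    using f(2) p by (simp add: strict_mono_less)
  ultimately show ?thesis by simp
qed

text \<open>Near the end, \<open>g\<close> adds the period \<open>r\<close> to the preimage of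
  \<open>t\<close> under \<open>f\<close>, and \<open>f\<close> turns this into adding
  \<open>s\<close> to \<open>t\<close>.\<close>

lemma translates_conj:
  assumes F: "is_end F" and f: "periodic_affine F f r s" "strict_mono f" "bij f"
    and g: "translates F g r"
  shows "translates F (f \<circ> g \<circ> inv_into UNIV f) s"
proof -
  let ?h = "inv_into UNIV f"
  have h: "filterlim ?h F F"
    using strict_mono_inv_real[OF f(2,3)] bij_imp_bij_inv[OF f(3)]
    by (intro filterlim_end F) (auto simp: bij_def)
  have fh: "f (?h t) = t" for t
    using f(3) by (simp add: bij_def surj_f_inv_f)
  have "\<forall>\<^sub>F t in F. g (?h t) = ?h t + of_int r"
    "\<forall>\<^sub>F t in F. f (?h t + of_int r) = f (?h t) + of_int s"
    using eventually_compose_filterlim[OF g[unfolded translates_def] h]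
      eventually_compose_filterlim[OF f(1)[unfolded periodic_affine_def] h] by simp_all
  then show ?thesis
    unfolding translates_def by eventually_elim (simp add: fh)
qed

text \<open>Evaluating the conjugate at \<open>f t\<close> gives \<open>f (g t) = f t + s\<close>,
  where \<open>g t\<close> is \<open>t + r\<close>. This is how periods are read off from a
  commensuration.\<close>

lemma periodic_affine_of_conj:
  assumes F: "is_end F" and f: "strict_mono f" "bij f"
    and g: "translates F g r" and c: "translates F (f \<circ> g \<circ> inv_into UNIV f) s"
  shows "periodic_affine F f r s"
proof -
  have "\<forall>\<^sub>F t in F. (f \<circ> g \<circ> inv_into UNIV f) (f t) = f t + of_int s"
    using eventually_compose_filterlim[OF c[unfolded translates_def] filterlim_end[OF F f(1)]] f(2)
    by (simp add: bij_def)
  with g show ?thesis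
    unfolding periodic_affine_def translates_def
    by eventually_elim (use f(2) in \<open>simp add: bij_def\<close>)
qed

lemma eventually_int_periodic_affine_iff:
  "eventually_int_periodic_affine f p q p' q' \<longleftrightarrow>
     periodic_affine at_top f p q \<and> periodic_affine at_bot f p' q'"
proof
  assume "eventually_int_periodic_affine f p q p' q'"
  then show "periodic_affine at_top f p q \<and> periodic_affine at_bot f p' q'"
    unfolding eventually_int_periodic_affine_def periodic_affine_def
      eventually_at_top_dense eventually_at_bot_dense by blast
next
  assume "periodic_affine at_top f p q \<and> periodic_affine at_bot f p' q'"
  then obtain M N where MN: "\<And>t. t > M \<Longrightarrow> f (t + of_int p) = f t + of_int q"
    "\<And>t. t < N \<Longrightarrow> f (t + of_int p') = f t + of_int q'"
    unfolding periodic_affine_def eventually_at_top_dense eventually_at_bot_dense by blast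
  show "eventually_int_periodic_affine f p q p' q'"
    unfolding eventually_int_periodic_affine_def
    by (rule exI[of _ "max M (- N)"]) (auto intro: MN)
qed

section \<open>Thompson's group in terms of ends\<close>

lemma thompson_F_iff:
  "f \<in> carrier thompson_F \<longleftrightarrow> f \<in> PL2 \<and> strict_mono f \<and>
     (\<exists>r. translates at_top f r) \<and> (\<exists>l. translates at_bot f l)"
proof
  assume "f \<in> carrier thompson_F"
  then show "f \<in> PL2 \<and> strict_mono f \<and>
     (\<exists>r. translates at_top f r) \<and> (\<exists>l. translates at_bot f l)"
    unfolding thompson_F_def translates_def eventually_at_top_dense eventually_at_bot_dense by auto
next
  assume f: "f \<in> PL2 \<and> strict_mono f \<and>
     (\<exists>r. translates at_top f r) \<and> (\<exists>l. translates at_bot f l)"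
  then obtain r l M N where MN: "\<And>t. t > M \<Longrightarrow> f t = t + of_int r" "\<And>t. t < N \<Longrightarrow> f t = t + of_int l"
    unfolding translates_def eventually_at_top_dense eventually_at_bot_dense by blast
  \<comment> \<open>One bound must serve both ends and also be positive; hence the maximum with
    1.\<close>
  have "\<exists>(l::int) (r::int) (M::real). M > 0 \<and> (\<forall>t>M. f t = t + of_int r) \<and>
      (\<forall>t. t < - M \<longrightarrow> f t = t + of_int l)"
    by (rule exI[of _ l], rule exI[of _ r], rule exI[of _ "max (max M (- N)) 1"]) (auto intro: MN)
  then show "f \<in> carrier thompson_F"
    using f unfolding thompson_F_def by simp
qed

lemma thompson_F_translates:
  assumes "f \<in> carrier thompson_F" "is_end F" shows "\<exists>r. translates F f r"
  using assms by (auto simp: thompson_F_iff is_end_def)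

lemma thompson_FI:
  assumes "f \<in> PL2" "strict_mono f" "\<And>F. is_end F \<Longrightarrow> \<exists>r. translates F f r"
  shows "f \<in> carrier thompson_F"
  using assms by (simp add: thompson_F_iff is_end_def)

lemma thompson_F_simps [simp]:
  "mult thompson_F = (\<circ>)" "one thompson_F = id"
  by (simp_all add: thompson_F_def)

lemma translation_thompson_F: "(\<lambda>t. t + of_int n) \<in> carrier thompson_F"
  by (rule thompson_FI[OF PL2_translation])
    (auto simp: translates_def intro: strict_monoI exI[of _ n])

lemma thompson_F_D:
  assumes "f \<in> carrier thompson_F" shows "f \<in> PL2" "strict_mono f" "bij f"
  using assms PL2_bij by (auto simp: thompson_F_iff)

lemma inv_thompson_F:
  assumes f: "f \<in> carrier thompson_F" shows "inv_into UNIV f \<in> carrier thompson_F"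
proof (rule thompson_FI)
  note D = thompson_F_D[OF f]
  show "inv_into UNIV f \<in> PL2" "strict_mono (inv_into UNIV f)"
    using PL2_inv[OF D(1)] strict_mono_inv_real[OF D(2,3)] by simp_all
  show "\<exists>r. translates F (inv_into UNIV f) r" if F: "is_end F" for F
    using thompson_F_translates[OF f F] translates_inv[OF F _ bij_is_inj[OF D(3)]] by blast
qed

lemma comp_thompson_F:
  assumes f: "f \<in> carrier thompson_F" and g: "g \<in> carrier thompson_F"
  shows "f \<circ> g \<in> carrier thompson_F"
proof (rule thompson_FI)
  show "f \<circ> g \<in> PL2" "strict_mono (f \<circ> g)"
    using PL2_comp thompson_F_D[OF f] thompson_F_D[OF g] by (auto simp: strict_mono_def)
  show "\<exists>r. translates F (f \<circ> g) r" if F: "is_end F" for F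
    using thompson_F_translates[OF f F] thompson_F_translates[OF g F] translates_comp[OF F] by blast
qed

lemma group_thompson_F: "group thompson_F"
proof (rule groupI)
  show "\<one>\<^bsub>thompson_F\<^esub> \<in> carrier thompson_F"
    using translation_thompson_F[of 0] by (simp add: id_def)
  show "\<exists>g\<in>carrier thompson_F. g \<otimes>\<^bsub>thompson_F\<^esub> f = \<one>\<^bsub>thompson_F\<^esub>" if "f \<in> carrier thompson_F" for f
    using inv_thompson_F[OF that] bij_is_inj[OF thompson_F_D(3)[OF that]]
    by (intro bexI[of _ "inv_into UNIV f"]) auto
qed (auto simp: comp_thompson_F)

lemma inv_thompson_F_eq:
  assumes "f \<in> carrier thompson_F" shows "inv\<^bsub>thompson_F\<^esub> f = inv_into UNIV f"
  using assms inv_thompson_F bij_is_inj[OF thompson_F_D(3)[OF assms]]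
  by (intro group.inv_equality[OF group_thompson_F]) auto

section \<open>Commensurations induced by conjugation\<close>

interpretation F: group thompson_F
  by (rule group_thompson_F)

text \<open>Pigeonhole: the translations by 0, 1, 2, ... fall into finitely many cosets of
  \<open>A\<close>, so two of them share a coset and their difference lies in
  \<open>A\<close>.\<close>

lemma finite_index_translation:
  assumes A: "finite_index thompson_F A"
  shows "\<exists>n>0. (\<lambda>t. t + of_int n) \<in> A"
proof -
  define T where "T n = (\<lambda>t::real. t + of_int n)" for n :: int
  have T: "T n \<in> carrier thompson_F" for n
    unfolding T_def by (rule translation_thompson_F)
  have "range (\<lambda>n::nat. A #>\<^bsub>thompson_F\<^esub> T (int n))
      \<subseteq> (\<lambda>g. A #>\<^bsub>thompson_F\<^esub> g) ` carrier thompson_F"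
    using T by blast
  then have "finite (range (\<lambda>n::nat. A #>\<^bsub>thompson_F\<^esub> T (int n)))"
    using F.finite_image_rcos[OF A] finite_subset by blast
  then have "\<not> inj (\<lambda>n::nat. A #>\<^bsub>thompson_F\<^esub> T (int n))"
    using finite_imageD infinite_UNIV_nat by blast
  then obtain i j :: nat
    where ij: "i < j" "A #>\<^bsub>thompson_F\<^esub> T (int j) = A #>\<^bsub>thompson_F\<^esub> T (int i)"
    unfolding inj_def by (metis linorder_neqE_nat)
  have "inv_into UNIV (T (int i)) = T (- int i)"
    by (rule inv_equality) (simp_all add: T_def)
  then have "T (int j) \<otimes>\<^bsub>thompson_F\<^esub> inv\<^bsub>thompson_F\<^esub> T (int i) = T (int j - int i)"
    by (simp only: inv_thompson_F_eq[OF T] thompson_F_simps) (simp add: T_def fun_eq_iff)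
  then have "T (int j - int i) \<in> A"
    using F.same_rcoset_imp[OF F.finite_index_subgroup[OF A] T T ij(2)] by simp
  then show ?thesis
    using ij(1) by (intro exI[of _ "int j - int i"]) (simp add: T_def)
qed

text \<open>\<open>induces\<close> refers to some representative of the class; since any other
  agrees with it on a finite-index subgroup, every representative is conjugation by \<open>f\<close>
  on such a subgroup.\<close>

lemma induces_on:
  assumes c: "c \<in> carrier (abstract_commensurator thompson_F)" and f: "induces f c"
    and x: "(A, B, \<phi>) \<in> c"
  shows "\<exists>C. finite_index thompson_F C \<and> C \<subseteq> A \<and> (\<forall>g\<in>C. \<phi> g = f \<circ> g \<circ> inv_into UNIV f)"
proof -
  obtain A' B' \<phi>' where y: "(A', B', \<phi>') \<in> c" "\<forall>g\<in>A'. \<phi>' g = f \<circ> g \<circ> inv_into UNIV f"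
    using f unfolding induces_def by blast
  have "((A', B', \<phi>'), (A, B, \<phi>)) \<in> comm_rel thompson_F"
    using F.mem_comm_carrier(2)[OF c y(1)] x by blast
  then obtain C where "finite_index thompson_F C" "C \<subseteq> A'" "C \<subseteq> A" "\<forall>g\<in>C. \<phi>' g = \<phi> g"
    by (elim F.comm_relE) blast
  then show ?thesis
    using y(2) by (metis subsetD)
qed

text \<open>Two maps that induce the same commensuration conjugate a common translation of \<open>F\<close> to the
  same element, hence share a pair of periods at each end.\<close>

lemma induces_common_periods:
  assumes c: "c \<in> carrier (abstract_commensurator thompson_F)"
    and f: "f \<in> PL2" "strict_mono f" "induces f c"
    and f': "f' \<in> PL2" "strict_mono f'" "induces f' c"
  shows "\<exists>n>0. \<forall>E. is_end E \<longrightarrow> (\<exists>s>0. periodic_affine E f n s \<and> periodic_affine E f' n s)"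
proof -
  obtain A B \<phi> where x: "(A, B, \<phi>) \<in> c"
    using f(3) unfolding induces_def by blast
  obtain C where C: "finite_index thompson_F C" "C \<subseteq> A" "\<forall>g\<in>C. \<phi> g = f \<circ> g \<circ> inv_into UNIV f"
    using induces_on[OF c f(3) x] by blast
  obtain C' where C': "finite_index thompson_F C'" "\<forall>g\<in>C'. \<phi> g = f' \<circ> g \<circ> inv_into UNIV f'"
    using induces_on[OF c f'(3) x] by blast
  obtain n where n: "n > 0" "(\<lambda>t. t + of_int n) \<in> C \<inter> C'"
    using finite_index_translation[OF F.finite_index_Int[OF C(1) C'(1)]] by blast
  define T where "T = (\<lambda>t::real. t + of_int n)"
  have eq: "\<phi> T = f \<circ> T \<circ> inv_into UNIV f" "\<phi> T = f' \<circ> T \<circ> inv_into UNIV f'" and TA: "T \<in> A"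
    using n(2) C(2,3) C'(2) unfolding T_def by auto
  have "(A, B, \<phi>) \<in> partial_isos thompson_F"
    using F.mem_comm_carrier(1)[OF c x] .
  \<comment> \<open>Both conjugates of \<open>T\<close> equal \<open>\<phi> T\<close>, which lies in
    F and so is a translation near each end; its length is the common increment.\<close>
  then have "\<phi> T \<in> B" "finite_index thompson_F B"
    using TA by (auto simp: F.partial_isos_iff dest: bij_betwE)
  then have \<phi>T: "\<phi> T \<in> carrier thompson_F"
    using F.finite_index_subset by blast
  have "\<exists>s>0. periodic_affine E f n s \<and> periodic_affine E f' n s" if E: "is_end E" for E
  proof -
    obtain s where s: "translates E (\<phi> T) s"
      using thompson_F_translates[OF \<phi>T E] by blast
    have T: "translates E T n"
      by (simp add: translates_def T_def)
    have "periodic_affine E f n s" "periodic_affine E f' n s"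
      using periodic_affine_of_conj[OF E f(2) PL2_bij[OF f(1)] T, of s]
        periodic_affine_of_conj[OF E f'(2) PL2_bij[OF f'(1)] T, of s] s eq by auto
    then show ?thesis
      using periodic_affine_pos[OF E _ f(2) n(1)] by blast
  qed
  then show ?thesis
    using n(1) by blast
qed

section \<open>The pair of ratios attached to a commensuration\<close>

text \<open>A choice among the values given by all inducing maps and all their positive periods;
  \<open>end_ratios_eq\<close> shows that these values coincide.\<close>

definition end_ratios :: "(real \<Rightarrow> real) partial_iso set \<Rightarrow> rat \<times> rat" where
  "end_ratios c = (SOME v. \<exists>f p q p' q'. f \<in> PL2 \<and> strict_mono f \<and> induces f c \<and>
     p > 0 \<and> q > 0 \<and> p' > 0 \<and> q' > 0 \<and> eventually_int_periodic_affine f p q p' q' \<and>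
     v = (of_int p / of_int q, of_int p' / of_int q'))"

lemma cross_mult_rat:
  assumes "n * q = p * s" "q > 0" "s > 0"
  shows "(of_int p / of_int q :: rat) = of_int n / of_int s"
proof -
  have "(of_int p * of_int s :: rat) = of_int n * of_int q"
    using assms(1) by (metis of_int_mult)
  then show ?thesis
    using assms by (simp add: frac_eq_eq)
qed

text \<open>Two inducing maps share a period \<open>n\<close> and, at each end, an increment
  \<open>s\<close>; by \<open>periodic_affine_unique\<close> both of their ratios there equal
  \<open>n / s\<close>.\<close>

lemma end_ratios_eq:
  assumes c: "c \<in> carrier (abstract_commensurator thompson_F)"
    and f: "f \<in> PL2" "strict_mono f" "induces f c"
    and pos: "p > 0" "q > 0" "p' > 0" "q' > 0"
    and per: "eventually_int_periodic_affine f p q p' q'"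
  shows "end_ratios c = (of_int p / of_int q, of_int p' / of_int q')"
  unfolding end_ratios_def
proof (rule some_equality)
  show "\<exists>g a b a' b'. g \<in> PL2 \<and> strict_mono g \<and> induces g c \<and>
     a > 0 \<and> b > 0 \<and> a' > 0 \<and> b' > 0 \<and> eventually_int_periodic_affine g a b a' b' \<and>
     (of_int p / of_int q, of_int p' / of_int q') = (of_int a / of_int b :: rat, of_int a' / of_int b' :: rat)"
    using assms by blast
  fix v :: "rat \<times> rat"
  assume "\<exists>g a b a' b'. g \<in> PL2 \<and> strict_mono g \<and> induces g c \<and>
     a > 0 \<and> b > 0 \<and> a' > 0 \<and> b' > 0 \<and> eventually_int_periodic_affine g a b a' b' \<and>
     v = (of_int a / of_int b, of_int a' / of_int b')"
  then obtain g a b a' b' where g: "g \<in> PL2" "strict_mono g" "induces g c"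
    and pos': "a > 0" "b > 0" "a' > 0" "b' > 0"
    and per': "eventually_int_periodic_affine g a b a' b'"
    and v: "v = (of_int a / of_int b, of_int a' / of_int b')"
    by blast
  obtain n where n: "n > 0"
    "\<And>E. is_end E \<Longrightarrow> \<exists>s>0. periodic_affine E f n s \<and> periodic_affine E g n s"
    using induces_common_periods[OF c f g] by blast
  have ratio: "(of_int x / of_int y :: rat) = of_int a / of_int b"
    if E: "is_end E" and xy: "periodic_affine E f x y" "y > 0"
      and ab: "periodic_affine E g a b" "b > 0" for E x y a b
  proof -
    obtain s where s: "s > 0" "periodic_affine E f n s" "periodic_affine E g n s"
      using n(2)[OF E] by blast
    show ?thesis
      using cross_mult_rat[OF periodic_affine_unique[OF E xy(1) s(2)] xy(2) s(1)]
        cross_mult_rat[OF periodic_affine_unique[OF E ab(1) s(3)] ab(2) s(1)] by simp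
  qed
  show "v = (of_int p / of_int q, of_int p' / of_int q')"
    using ratio[OF is_end_at_top, of p q a b] ratio[OF is_end_at_bot, of p' q' a' b']
      per per' pos pos' v by (simp add: eventually_int_periodic_affine_iff)
qed

lemma induces_periods:
  assumes c: "c \<in> carrier (abstract_commensurator thompson_F)"
    and f: "f \<in> PL2" "strict_mono f" "induces f c"
  shows "\<exists>p q p' q'. p > 0 \<and> q > 0 \<and> p' > 0 \<and> q' > 0 \<and> eventually_int_periodic_affine f p q p' q'"
  using induces_common_periods[OF c f f] is_end_at_top is_end_at_bot
  unfolding eventually_int_periodic_affine_iff by metis

lemma induces_comp:
  assumes c: "c \<in> carrier (abstract_commensurator thompson_F)" "d \<in> carrier (abstract_commensurator thompson_F)"
    and f: "bij f" "induces f c" and g: "bij g" "induces g d"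
  shows "induces (f \<circ> g) (c \<otimes>\<^bsub>abstract_commensurator thompson_F\<^esub> d)"
proof -
  obtain A B \<phi> where x: "(A, B, \<phi>) \<in> c" "\<forall>h\<in>A. \<phi> h = f \<circ> h \<circ> inv_into UNIV f"
    using f(2) unfolding induces_def by blast
  obtain A' B' \<phi>' where y: "(A', B', \<phi>') \<in> d" "\<forall>h\<in>A'. \<phi>' h = g \<circ> h \<circ> inv_into UNIV g"
    using g(2) unfolding induces_def by blast
  have "inv_into UNIV (f \<circ> g) = inv_into UNIV g \<circ> inv_into UNIV f"
    using f(1) g(1) by (rule o_inv_distrib)
  then have "(\<phi> \<circ> \<phi>') h = (f \<circ> g) \<circ> h \<circ> inv_into UNIV (f \<circ> g)"
    if "h \<in> A'" "\<phi>' h \<in> A" for h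
    using bspec[OF x(2) that(2)] bspec[OF y(2) that(1)] by (simp add: o_assoc)
  then show ?thesis
    using F.mem_mult_comm_class[OF c x(1) y(1)] unfolding induces_def partial_comp.simps
    by (intro exI conjI) auto
qed

lemma induces_inv:
  assumes c: "c \<in> carrier (abstract_commensurator thompson_F)" and f: "bij f" "induces f c"
  shows "induces (inv_into UNIV f) (inv\<^bsub>abstract_commensurator thompson_F\<^esub> c)"
proof -
  obtain A B \<phi> where x: "(A, B, \<phi>) \<in> c" "\<forall>h\<in>A. \<phi> h = f \<circ> h \<circ> inv_into UNIV f"
    using f(2) unfolding induces_def by blast
  have bij: "bij_betw \<phi> A B"
    using F.mem_comm_carrier(1)[OF c x(1)] by (simp add: F.partial_isos_iff)
  have "inv_into A \<phi> h = inv_into UNIV f \<circ> h \<circ> inv_into UNIV (inv_into UNIV f)" if h: "h \<in> B" for h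
  proof -
    obtain g where g: "g \<in> A" "h = \<phi> g"
      using bij h by (auto simp: bij_betw_def)
    then have "inv_into A \<phi> h = g"
      using bij by (simp add: bij_betw_def)
    moreover have "inv_into UNIV f \<circ> (f \<circ> g \<circ> inv_into UNIV f) \<circ> f = g"
      using bij_is_inj[OF f(1)] by (auto simp: fun_eq_iff)
    ultimately show ?thesis
      using g x(2) inv_inv_eq[OF f(1)] by simp
  qed
  then show ?thesis
    using F.inverse_mem_inv[OF c x(1)] unfolding induces_def by blast
qed

section \<open>The group of order-preserving commensurations\<close>

lemma Com_plus_F_iff:
  "c \<in> carrier Com_plus_F \<longleftrightarrow> c \<in> carrier (abstract_commensurator thompson_F) \<and>
     (\<exists>f\<in>PL2. strict_mono f \<and> induces f c)"
  by (simp add: Com_plus_F_def)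

lemma mult_Com_plus_F [simp]: "mult Com_plus_F = mult (abstract_commensurator thompson_F)"
  by (simp add: Com_plus_F_def)

lemma Com_plus_F_mult_inducer:
  assumes c: "c \<in> carrier (abstract_commensurator thompson_F)" "d \<in> carrier (abstract_commensurator thompson_F)"
    and f: "f \<in> PL2" "strict_mono f" "induces f c" and g: "g \<in> PL2" "strict_mono g" "induces g d"
  shows "f \<circ> g \<in> PL2" "strict_mono (f \<circ> g)" "induces (f \<circ> g) (c \<otimes>\<^bsub>abstract_commensurator thompson_F\<^esub> d)"
  using PL2_comp[OF f(1) g(1)] f(2) g(2)
    induces_comp[OF c PL2_bij[OF f(1)] f(3) PL2_bij[OF g(1)] g(3)]
  by (auto simp: strict_mono_def)

text \<open>A subgroup of the abstract commensurator: products, inverses and the identity are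
  induced by composites, inverses and \<open>id\<close>, all increasing elements of
  \<open>PL2\<close>.\<close>

lemma group_Com_plus_F: "group Com_plus_F"
proof -
  let ?K = "abstract_commensurator thompson_F"
  interpret K: group ?K
    by (rule F.group_abstract_commensurator)
  have "subgroup (carrier Com_plus_F) ?K"
  proof (rule K.subgroupI)
    show "carrier Com_plus_F \<subseteq> carrier ?K"
      by (auto simp: Com_plus_F_iff)
    have "induces id \<one>\<^bsub>?K\<^esub>"
      using F.id_mem_one unfolding induces_def by (metis comp_id id_apply id_comp inv_id)
    moreover have "id \<in> PL2" "strict_mono (id :: real \<Rightarrow> real)"
      using PL2_translation[of 0] by (auto simp: id_def strict_mono_def)
    ultimately have "\<one>\<^bsub>?K\<^esub> \<in> carrier Com_plus_F"
      by (auto simp: Com_plus_F_iff)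
    then show "carrier Com_plus_F \<noteq> {}" by blast
    fix c assume c: "c \<in> carrier Com_plus_F"
    then obtain f where f: "f \<in> PL2" "strict_mono f" "induces f c"
      by (auto simp: Com_plus_F_iff)
    have cK: "c \<in> carrier ?K"
      using c by (simp add: Com_plus_F_iff)
    show "inv\<^bsub>?K\<^esub> c \<in> carrier Com_plus_F"
      using PL2_inv[OF f(1)] strict_mono_inv_real[OF f(2) PL2_bij[OF f(1)]]
        induces_inv[OF cK PL2_bij[OF f(1)] f(3)] K.inv_closed[OF cK]
      unfolding Com_plus_F_iff by blast
    fix d assume d: "d \<in> carrier Com_plus_F"
    then obtain g where g: "g \<in> PL2" "strict_mono g" "induces g d"
      by (auto simp: Com_plus_F_iff)
    have dK: "d \<in> carrier ?K"
      using d by (simp add: Com_plus_F_iff)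
    show "c \<otimes>\<^bsub>?K\<^esub> d \<in> carrier Com_plus_F"
      using Com_plus_F_mult_inducer[OF cK dK f g] K.m_closed[OF cK dK]
      unfolding Com_plus_F_iff by blast
  qed
  then have "group (?K\<lparr>carrier := carrier Com_plus_F\<rparr>)"
    by (rule subgroup.subgroup_is_group) (rule K.is_group)
  then show ?thesis
    by (simp add: Com_plus_F_def)
qed

lemma end_ratios_mult:
  assumes c: "c \<in> carrier Com_plus_F" and d: "d \<in> carrier Com_plus_F"
  shows "end_ratios (c \<otimes>\<^bsub>Com_plus_F\<^esub> d) =
    (fst (end_ratios c) * fst (end_ratios d), snd (end_ratios c) * snd (end_ratios d))"
proof -
  interpret K: group "abstract_commensurator thompson_F"
    by (rule F.group_abstract_commensurator)
  have cK: "c \<in> carrier (abstract_commensurator thompson_F)"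
    and dK: "d \<in> carrier (abstract_commensurator thompson_F)"
    using c d by (simp_all add: Com_plus_F_iff)
  obtain f where f: "f \<in> PL2" "strict_mono f" "induces f c"
    using c by (auto simp: Com_plus_F_iff)
  obtain g where g: "g \<in> PL2" "strict_mono g" "induces g d"
    using d by (auto simp: Com_plus_F_iff)
  obtain p q p' q' where pos: "p > 0" "q > 0" "p' > 0" "q' > 0"
    and per: "eventually_int_periodic_affine f p q p' q'"
    using induces_periods[OF cK f] by blast
  obtain a b a' b' where pos': "a > 0" "b > 0" "a' > 0" "b' > 0"
    and per': "eventually_int_periodic_affine g a b a' b'"
    using induces_periods[OF dK g] by blast
  \<comment> \<open>Scaling the periods of \<open>g\<close> by \<open>p\<close> and those of
    \<open>f\<close> by \<open>b\<close> makes the increment of \<open>g\<close> and the period of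
    \<open>f\<close> agree at \<open>p * b\<close>.\<close>
  have comp: "periodic_affine E (f \<circ> g) (p * a) (q * b)"
    if E: "is_end E" and "periodic_affine E f p q" "periodic_affine E g a b" for E p q a b
  proof (rule periodic_affine_comp[OF E])
    show "periodic_affine E f (p * b) (q * b)"
      using periodic_affine_mult[OF E that(2), of b] by (simp add: mult.commute)
    show "periodic_affine E g (p * a) (p * b)"
      by (rule periodic_affine_mult[OF E that(3)])
    show "strict_mono g" "surj g"
      using g(2) bij_is_surj[OF PL2_bij[OF g(1)]] by simp_all
  qed
  have "end_ratios (c \<otimes>\<^bsub>abstract_commensurator thompson_F\<^esub> d) =
      (of_int (p * a) / of_int (q * b), of_int (p' * a') / of_int (q' * b'))"
  proof (rule end_ratios_eq[OF K.m_closed[OF cK dK] Com_plus_F_mult_inducer[OF cK dK f g]])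
    show "eventually_int_periodic_affine (f \<circ> g) (p * a) (q * b) (p' * a') (q' * b')"
      using per per' comp[OF is_end_at_top] comp[OF is_end_at_bot]
      by (simp add: eventually_int_periodic_affine_iff)
  qed (use pos pos' in simp_all)
  then show ?thesis
    using end_ratios_eq[OF cK f pos per] end_ratios_eq[OF dK g pos' per'] by simp
qed

section \<open>Commensurations induced by periodic maps\<close>

text \<open>With F for Thompson's group, this is the intersection of F with the conjugate of F by
  the inverse of \<open>f\<close>: the largest part of F that conjugation by \<open>f\<close> keeps
  inside F.\<close>

definition conj_domain :: "(real \<Rightarrow> real) \<Rightarrow> (real \<Rightarrow> real) set" where
  "conj_domain f = {g \<in> carrier thompson_F. f \<circ> g \<circ> inv_into UNIV f \<in> carrier thompson_F}"

text \<open>The quotient of \<open>g\<close> by \<open>h\<close> translates by a multiple of the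
  period \<open>p\<close>, and conjugation by \<open>f\<close> turns such a translation into an
  integer translation.\<close>

lemma translates_conj_congruent:
  assumes E: "is_end E" and f: "periodic_affine E f p q" "strict_mono f" "bij f"
    and g: "translates E g r" and h: "translates E h s" "inj h" and rs: "r mod p = s mod p"
  shows "\<exists>k. translates E (f \<circ> (g \<circ> inv_into UNIV h) \<circ> inv_into UNIV f) k"
proof -
  have "p dvd r - s"
    using rs by (simp add: mod_eq_dvd_iff)
  then obtain k where k: "r + - s = k * p"
    by (auto simp: dvd_def mult.commute)
  have "translates E (g \<circ> inv_into UNIV h) (k * p)"
    using translates_comp[OF E g translates_inv[OF E h]] unfolding k .
  then show ?thesis
    using translates_conj[OF E periodic_affine_mult[OF E f(1), of k] f(2,3)] by blast
qed

lemma finite_index_conj_domain: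
  assumes f: "f \<in> PL2" "strict_mono f"
    and per: "eventually_int_periodic_affine f p q p' q'" and p: "p > 0" "p' > 0"
  shows "finite_index thompson_F (conj_domain f)"
proof -
  let ?i = "inv_into UNIV f"
  note bij = PL2_bij[OF f(1)]
  have ff: "?i (f t) = t" "f (?i t) = t" for t
    using bij by (auto simp: bij_def surj_f_inv_f)
  have per': "periodic_affine at_top f p q" "periodic_affine at_bot f p' q'"
    using per by (simp_all add: eventually_int_periodic_affine_iff)
  define rt where "rt g = (SOME r. translates at_top g r)" for g
  define lt where "lt g = (SOME l. translates at_bot g l)" for g
  have rt: "translates at_top g (rt g)" and lt: "translates at_bot g (lt g)"
    if "g \<in> carrier thompson_F" for g
    using thompson_F_translates[OF that is_end_at_top] thompson_F_translates[OF that is_end_at_bot]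
    unfolding rt_def lt_def by (auto intro: someI)
  \<comment> \<open>The colour records the translation lengths at the two ends modulo the periods of
    \<open>f\<close>, so at most \<open>p * p'\<close> colours occur.\<close>
  define \<kappa> where "\<kappa> g = (rt g mod p, lt g mod p')" for g
  show ?thesis
  proof (rule F.finite_indexI)
    show "subgroup (conj_domain f) thompson_F"
    proof (rule F.subgroupI)
      show "conj_domain f \<subseteq> carrier thompson_F"
        by (auto simp: conj_domain_def)
      have "f \<circ> id \<circ> ?i = id"
        using ff by (simp add: fun_eq_iff)
      then have "id \<in> conj_domain f"
        using F.one_closed by (simp add: conj_domain_def)
      then show "conj_domain f \<noteq> {}" by blast
      fix g assume g: "g \<in> conj_domain f"
      then have gF: "g \<in> carrier thompson_F" by (simp add: conj_domain_def)
      have gg: "inv_into UNIV g (g t) = t" "g (inv_into UNIV g t) = t" for t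
        using thompson_F_D(3)[OF gF] by (auto simp: bij_def surj_f_inv_f)
      have "inv_into UNIV (f \<circ> g \<circ> ?i) = f \<circ> inv_into UNIV g \<circ> ?i"
        by (rule inv_equality) (simp_all add: ff gg)
      then show "inv\<^bsub>thompson_F\<^esub> g \<in> conj_domain f"
        using g inv_thompson_F[of "f \<circ> g \<circ> ?i"] inv_thompson_F[OF gF] inv_thompson_F_eq[OF gF]
        by (simp add: conj_domain_def)
      fix h assume h: "h \<in> conj_domain f"
      have "f \<circ> (g \<circ> h) \<circ> ?i = (f \<circ> g \<circ> ?i) \<circ> (f \<circ> h \<circ> ?i)"
        by (simp add: fun_eq_iff ff)
      then show "g \<otimes>\<^bsub>thompson_F\<^esub> h \<in> conj_domain f"
        using g h comp_thompson_F by (auto simp: conj_domain_def)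
    qed
    have "\<kappa> ` carrier thompson_F \<subseteq> {0..<p} \<times> {0..<p'}"
      using p by (auto simp: \<kappa>_def)
    then show "finite (\<kappa> ` carrier thompson_F)"
      by (rule finite_subset) simp
    fix g h assume g: "g \<in> carrier thompson_F" and h: "h \<in> carrier thompson_F" and eq: "\<kappa> g = \<kappa> h"
    note hinj = bij_is_inj[OF thompson_F_D(3)[OF h]]
    have gh: "g \<circ> inv_into UNIV h \<in> carrier thompson_F"
      using comp_thompson_F[OF g inv_thompson_F[OF h]] .
    have "f \<circ> (g \<circ> inv_into UNIV h) \<circ> ?i \<in> carrier thompson_F"
    proof (rule thompson_FI)
      show "f \<circ> (g \<circ> inv_into UNIV h) \<circ> ?i \<in> PL2"
        by (intro PL2_comp PL2_inv f thompson_F_D(1)[OF gh])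
      show "strict_mono (f \<circ> (g \<circ> inv_into UNIV h) \<circ> ?i)"
        using f(2) thompson_F_D(2)[OF gh] strict_mono_inv_real[OF f(2) bij]
        by (simp add: strict_mono_def)
      show "\<exists>r. translates E (f \<circ> (g \<circ> inv_into UNIV h) \<circ> ?i) r" if "is_end E" for E
        using that eq rt[OF g] rt[OF h] lt[OF g] lt[OF h]
          translates_conj_congruent[OF is_end_at_top per'(1) f(2) bij _ _ hinj]
          translates_conj_congruent[OF is_end_at_bot per'(2) f(2) bij _ _ hinj]
        by (auto simp: is_end_def \<kappa>_def)
    qed
    then show "g \<otimes>\<^bsub>thompson_F\<^esub> inv\<^bsub>thompson_F\<^esub> h \<in> conj_domain f"
      using gh inv_thompson_F_eq[OF h] by (simp add: conj_domain_def)
  qed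
qed

text \<open>Conjugation by \<open>f\<close> maps \<open>conj_domain f\<close> bijectively onto the
  \<open>conj_domain\<close> of the inverse. Both have finite index, because the inverse is again
  periodic, with periods and increments exchanged.\<close>

lemma inducer_commensuration:
  assumes f: "f \<in> PL2" "strict_mono f"
    and per: "eventually_int_periodic_affine f p q p' q'"
    and pos: "p > 0" "q > 0" "p' > 0" "q' > 0"
  shows "\<exists>c\<in>carrier Com_plus_F. induces f c"
proof -
  let ?i = "inv_into UNIV f"
  note bij = PL2_bij[OF f(1)]
  have ff: "?i (f t) = t" "f (?i t) = t" for t
    using bij by (auto simp: bij_def surj_f_inv_f)
  have ii: "inv_into UNIV ?i = f"
    using bij by (rule inv_inv_eq)
  have i: "?i \<in> PL2" "strict_mono ?i"
    using PL2_inv[OF f(1)] strict_mono_inv_real[OF f(2) bij] by simp_all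
  have per_i: "eventually_int_periodic_affine ?i q p q' p'"
    using per periodic_affine_inv[OF is_end_at_top _ f(2) bij]
      periodic_affine_inv[OF is_end_at_bot _ f(2) bij]
    by (simp add: eventually_int_periodic_affine_iff)
  define \<phi> where "\<phi> g = f \<circ> g \<circ> ?i" for g
  have cancel: "?i \<circ> \<phi> g \<circ> f = g" "\<phi> (?i \<circ> g \<circ> f) = g" for g
    by (simp_all add: \<phi>_def fun_eq_iff ff)
  have "bij_betw \<phi> (conj_domain f) (conj_domain ?i)"
    by (rule bij_betw_byWitness[where f' = "\<lambda>g. ?i \<circ> g \<circ> f"])
      (auto simp: cancel conj_domain_def ii simp flip: \<phi>_def)
  moreover have "\<phi> (g \<circ> h) = \<phi> g \<circ> \<phi> h" for g h
    by (simp add: \<phi>_def fun_eq_iff ff)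
  ultimately have x: "(conj_domain f, conj_domain ?i, \<phi>) \<in> partial_isos thompson_F"
    using finite_index_conj_domain[OF f per pos(1,3)] finite_index_conj_domain[OF i per_i pos(2,4)]
    by (simp add: F.partial_isos_iff)
  define c where "c = F.comm_class (conj_domain f, conj_domain ?i, \<phi>)"
  have "(conj_domain f, conj_domain ?i, \<phi>) \<in> c"
    unfolding c_def by (rule F.comm_class_self[OF x])
  then have "induces f c"
    unfolding induces_def \<phi>_def by blast
  moreover have "c \<in> carrier Com_plus_F"
    using F.comm_class_carrier[OF x] \<open>induces f c\<close> f unfolding Com_plus_F_iff c_def[symmetric]
    by blast
  ultimately show ?thesis by blast
qed

section \<open>Maps with prescribed end ratios\<close>

text \<open>The continuous map with value \<open>a m\<close> at each integer \<open>m\<close> that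
  is affine between consecutive integers.\<close>

definition interpolate :: "(int \<Rightarrow> real) \<Rightarrow> real \<Rightarrow> real" where
  "interpolate a t = a \<lfloor>t\<rfloor> + (a (\<lfloor>t\<rfloor> + 1) - a \<lfloor>t\<rfloor>) * frac t"

context
  fixes a :: "int \<Rightarrow> real" and \<delta> :: real
  assumes \<delta>: "\<delta> > 0" and incr: "\<And>m. a (m + 1) - a m \<ge> \<delta>"
begin

lemma interpolate_base_mono: "m \<le> n \<Longrightarrow> a m + of_int (n - m) * \<delta> \<le> a n"
proof (induction n rule: int_ge_induct)
  case (step n)
  then show ?case
    using incr[of n] by (simp add: algebra_simps)
qed simp

lemma interpolate_bounds: "a \<lfloor>t\<rfloor> \<le> interpolate a t" "interpolate a t < a (\<lfloor>t\<rfloor> + 1)"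
proof -
  have d: "0 < a (\<lfloor>t\<rfloor> + 1) - a \<lfloor>t\<rfloor>"
    using \<delta> incr[of "\<lfloor>t\<rfloor>"] by linarith
  show "a \<lfloor>t\<rfloor> \<le> interpolate a t"
    using d by (simp add: interpolate_def frac_ge_0)
  have "(a (\<lfloor>t\<rfloor> + 1) - a \<lfloor>t\<rfloor>) * frac t < (a (\<lfloor>t\<rfloor> + 1) - a \<lfloor>t\<rfloor>) * 1"
    using d frac_lt_1 by (intro mult_strict_left_mono)
  then show "interpolate a t < a (\<lfloor>t\<rfloor> + 1)"
    by (simp add: interpolate_def)
qed

text \<open>Inside one unit interval fractional parts decide; otherwise the value of
  \<open>a\<close> at the integer following \<open>s\<close> separates the two values.\<close>

lemma strict_mono_interpolate: "strict_mono (interpolate a)"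
proof (rule strict_monoI)
  fix s t :: real assume st: "s < t"
  show "interpolate a s < interpolate a t"
  proof (cases "\<lfloor>s\<rfloor> = \<lfloor>t\<rfloor>")
    case True
    then have "frac s < frac t"
      using st by (simp add: frac_def)
    then show ?thesis
      using \<delta> incr[of "\<lfloor>t\<rfloor>"] True by (simp add: interpolate_def)
  next
    case False
    then have "\<lfloor>s\<rfloor> + 1 \<le> \<lfloor>t\<rfloor>"
      using floor_mono[of s t] st by simp
    then have "a (\<lfloor>s\<rfloor> + 1) + 0 \<le> a \<lfloor>t\<rfloor>"
      using interpolate_base_mono[of "\<lfloor>s\<rfloor> + 1" "\<lfloor>t\<rfloor>"] \<delta>
      by (smt (verit) mult_nonneg_nonneg of_int_nonneg)
    then show ?thesis
      using interpolate_bounds[of s] interpolate_bounds[of t] by linarith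
  qed
qed

text \<open>The uniform increment \<open>\<delta>\<close> makes \<open>a\<close> unbounded both
  ways, so \<open>y\<close> lies between \<open>a (- K)\<close> and \<open>a K\<close> for large
  \<open>K\<close>. With \<open>M\<close> the last index in this range such that
  \<open>a M \<le> y\<close>, the affine formula on the unit interval from \<open>M\<close> is
  solved for the offset \<open>u\<close>.\<close>

lemma surj_interpolate: "surj (interpolate a)"
  unfolding surj_def
proof
  fix y :: real
  define K where "K = \<lceil>\<bar>y - a 0\<bar> / \<delta>\<rceil>"
  have K: "K \<ge> 0" "\<bar>y - a 0\<bar> \<le> of_int K * \<delta>"
  proof -
    have "\<bar>y - a 0\<bar> / \<delta> \<le> of_int K" "0 \<le> \<bar>y - a 0\<bar> / \<delta>"
      using \<delta> by (auto simp: K_def)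
    then show "K \<ge> 0" "\<bar>y - a 0\<bar> \<le> of_int K * \<delta>"
      using \<delta> by (linarith, simp add: pos_divide_le_eq)
  qed
  define M where "M = Max {m \<in> {- K..K}. a m \<le> y}"
  have lo: "a (- K) \<le> y" and hi: "y \<le> a K"
    using interpolate_base_mono[of "- K" 0] interpolate_base_mono[of 0 K] K by auto
  have M: "M \<in> {m \<in> {- K..K}. a m \<le> y}"
    unfolding M_def
  proof (rule Max_in)
    show "finite {m \<in> {- K..K}. a m \<le> y}"
      by (rule finite_subset[of _ "{- K..K}"]) auto
    have "- K \<in> {m \<in> {- K..K}. a m \<le> y}"
      using lo K(1) by simp
    then show "{m \<in> {- K..K}. a m \<le> y} \<noteq> {}" by blast
  qed
  have "y < a (M + 1)"
  proof (cases "M = K")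
    case True
    then show ?thesis
      using hi incr[of M] \<delta> by simp
  next
    case False
    then have "M + 1 \<in> {- K..K}"
      using M by auto
    moreover have "M + 1 \<notin> {m \<in> {- K..K}. a m \<le> y}"
    proof
      assume "M + 1 \<in> {m \<in> {- K..K}. a m \<le> y}"
      then have "M + 1 \<le> M"
        unfolding M_def by (rule Max_ge[OF finite_subset[of _ "{- K..K}"], rotated -1]) auto
      then show False by simp
    qed
    ultimately show ?thesis by auto
  qed
  define u where "u = (y - a M) / (a (M + 1) - a M)"
  have d: "a (M + 1) - a M > 0"
    using \<delta> incr[of M] by linarith
  have u: "0 \<le> u" "u < 1" "(a (M + 1) - a M) * u = y - a M"
    using d M \<open>y < a (M + 1)\<close> by (auto simp: u_def)
  then have "\<lfloor>of_int M + u\<rfloor> = M"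
    by (simp add: floor_eq_iff)
  then have "interpolate a (of_int M + u) = y"
    using u by (simp add: interpolate_def frac_def)
  then show "\<exists>x. y = interpolate a x" by metis
qed

text \<open>All breakpoints are integers, and on each unit interval the slope is an increment of
  \<open>a\<close>.\<close>

lemma interpolate_PL2:
  assumes dy: "\<And>m. a m \<in> dyadics" and slope: "\<And>m. dyadic_slope (a (m + 1) - a m)"
  shows "interpolate a \<in> PL2"
proof (rule PL2I)
  show "homeomorphism UNIV UNIV (interpolate a) (inv_into UNIV (interpolate a))"
    by (intro strict_mono_surj_homeomorphism strict_mono_interpolate surj_interpolate)
  show "locally_finite_set \<int>"
    unfolding locally_finite_set_def
  proof (intro allI)
    fix x y :: real
    have "\<int> \<inter> {x..y} = {z \<in> \<int>. x \<le> z \<and> z \<le> y}" by auto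
    then show "finite (\<int> \<inter> {x..y})"
      using finite_int_segment by simp
  qed
  show "\<int> \<subseteq> dyadics"
    by (auto simp: dyadics_of_int elim: Ints_cases)
  fix t :: real
  show "\<exists>m. dyadic_slope m \<and> affine_near (interpolate a) m t" if t: "t \<notin> \<int>"
  proof (intro exI conjI)
    let ?n = "\<lfloor>t\<rfloor>"
    show "dyadic_slope (a (?n + 1) - a ?n)" by (rule slope)
    have "of_int ?n < t" "t < of_int ?n + 1"
      using t floor_correct[of t] by (metis Ints_of_int order_le_less) linarith
    then have "\<forall>\<^sub>F y in nhds t. y \<in> {of_int ?n<..<of_int ?n + 1}"
      by (intro eventually_nhds_in_open) auto
    then have "\<forall>\<^sub>F y in nhds t. interpolate a y = (a (?n + 1) - a ?n) * y +
        (a ?n - (a (?n + 1) - a ?n) * of_int ?n)"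
    proof eventually_elim
      case (elim y)
      then have "\<lfloor>y\<rfloor> = ?n" by (simp add: floor_eq_iff)
      then show ?case by (simp add: interpolate_def frac_def algebra_simps)
    qed
    then show "affine_near (interpolate a) (a (?n + 1) - a ?n) t"
      unfolding affine_near_def by blast
  qed
  show "interpolate a t \<in> dyadics" if "t \<in> dyadics"
    unfolding interpolate_def frac_def
    by (intro dyadics_add dyadics_mult dyadics_diff dyadics_of_int dy that)
qed

end

text \<open>Only the two nodes around \<open>t\<close> enter, so the shift can be used on one
  half-line when \<open>a\<close> is periodic only on that side.\<close>

lemma interpolate_shift:
  assumes "a (\<lfloor>t\<rfloor> + p) = a \<lfloor>t\<rfloor> + of_int q" "a (\<lfloor>t\<rfloor> + 1 + p) = a (\<lfloor>t\<rfloor> + 1) + of_int q"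
  shows "interpolate a (t + of_int p) = interpolate a t + of_int q"
proof -
  have "\<lfloor>t + of_int p\<rfloor> = \<lfloor>t\<rfloor> + p" "frac (t + of_int p) = frac t"
    by (simp_all add: frac_def)
  moreover have "a (\<lfloor>t\<rfloor> + p + 1) = a (\<lfloor>t\<rfloor> + 1) + of_int q"
    using assms(2) by (simp add: ac_simps)
  ultimately show ?thesis
    using assms(1) by (simp add: interpolate_def)
qed

section \<open>Sequences with power-of-two increments\<close>

text \<open>The increments are the floor or the ceiling of \<open>y\<close>. The range of
  \<open>y\<close> leaves just 1 and 2, both powers of two.\<close>

lemma floor_mult_step:
  fixes y :: real
  assumes "1 \<le> y" "y < 2"
  shows "\<lfloor>y * of_int (m + 1)\<rfloor> - \<lfloor>y * of_int m\<rfloor> \<in> {1, 2}"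
proof -
  have "y * of_int (m + 1) = y * of_int m + y"
    by (simp add: algebra_simps)
  then show ?thesis
    using assms by simp linarith
qed

text \<open>The slope \<open>n / d\<close> is split as \<open>2 powi k * y\<close> with \<open>1 \<le> y < 2\<close>, so that the increments of
  \<open>m \<mapsto> 2 powi k * \<lfloor>y * m\<rfloor>\<close> are powers of two.\<close>

lemma dyadic_normalization:
  fixes n d :: int
  assumes "n > 0" "d > 0"
  obtains k :: int and y :: real and p q w :: int
  where "1 \<le> y" "y < 2" "p > 0" "q > 0" "y * of_int p = of_int w" "2 powi k * of_int w = (of_int q :: real)"
    "p * n = q * d"
proof -
  define x where "x = (of_int n / of_int d :: real)"
  have x: "x > 0" "x * of_int d = of_int n"
    using assms by (auto simp: x_def)
  \<comment> \<open>The binary order of magnitude of \<open>x\<close>, so that dividing by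
    \<open>2 powi k\<close> lands in the interval from 1 up to, but excluding, 2.\<close>
  define k where "k = \<lfloor>log 2 x\<rfloor>"
  have "of_int k \<le> log 2 x" "log 2 x < of_int k + 1"
    by (simp_all add: k_def)
  then have "2 powr of_int k \<le> x" "x < 2 powr (of_int k + 1)"
    using x(1) by (simp_all add: le_log_iff log_less_iff)
  then have kx: "2 powi k \<le> x" "x < 2 * 2 powi k"
    by (simp_all add: powr_add powr_real_of_int')
  \<comment> \<open>Natural exponents with \<open>2 powi k * 2 ^ j = 2 ^ e\<close> for either sign
    of \<open>k\<close>. They clear denominators: the period is \<open>d * 2 ^ e\<close>, the
    increment \<open>n * 2 ^ e\<close>, and \<open>w\<close> is \<open>n * 2 ^ j\<close>.\<close>
  define e where "e = nat \<bar>k\<bar>"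
  define j where "j = nat (\<bar>k\<bar> - k)"
  have ej: "2 powi k * 2 ^ j = (2 ^ e :: real)"
  proof -
    have "2 powi k * 2 powi (\<bar>k\<bar> - k) = (2 powi \<bar>k\<bar> :: real)"
      by (simp flip: power_int_add)
    moreover have "2 powi (\<bar>k\<bar> - k) = (2 ^ j :: real)" "2 powi \<bar>k\<bar> = (2 ^ e :: real)"
      using power_int_of_nat[of "2::real" j] power_int_of_nat[of "2::real" e]
      by (simp_all add: e_def j_def abs_ge_self)
    ultimately show ?thesis by simp
  qed
  have pk: "(2::real) powi k > 0" by simp
  show ?thesis
  proof (rule that)
    show "1 \<le> x / 2 powi k" "x / 2 powi k < 2"
      using kx pk by (simp_all add: pos_le_divide_eq pos_divide_less_eq)
    show "d * 2 ^ e > 0" "n * 2 ^ e > 0"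
      using assms by simp_all
    have "x / 2 powi k * of_int (d * 2 ^ e) = of_int n * (2 ^ e / 2 powi k)"
      using x(2) by (simp add: field_simps)
    also have "2 ^ e / 2 powi k = (2 ^ j :: real)"
      using ej[symmetric] pk by simp
    finally show "x / 2 powi k * of_int (d * 2 ^ e) = of_int (n * 2 ^ j)"
      by simp
    show "2 powi k * of_int (n * 2 ^ j) = (of_int (n * 2 ^ e) :: real)"
      using ej by (simp add: algebra_simps)
    show "d * 2 ^ e * n = n * 2 ^ e * d"
      by simp
  qed
qed

lemma exists_PL2_with_ratios:
  fixes n d n' d' :: int
  assumes "n > 0" "d > 0" "n' > 0" "d' > 0"
  shows "\<exists>f\<in>PL2. strict_mono f \<and> (\<exists>p q p' q'. p > 0 \<and> q > 0 \<and> p' > 0 \<and> q' > 0 \<and>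
     p * n = q * d \<and> p' * n' = q' * d' \<and> eventually_int_periodic_affine f p q p' q')"
proof -
  obtain k p q w :: int and y :: real where r: "1 \<le> y" "y < 2" "p > 0" "q > 0" "y * of_int p = of_int w"
    "2 powi k * of_int w = real_of_int q" "p * n = q * d"
    using dyadic_normalization[OF assms(1,2)] by metis
  obtain k' p' q' w' :: int and y' :: real where l: "1 \<le> y'" "y' < 2" "p' > 0" "q' > 0" "y' * of_int p' = of_int w'"
    "2 powi k' * of_int w' = real_of_int q'" "p' * n' = q' * d'"
    using dyadic_normalization[OF assms(3,4)] by metis
  \<comment> \<open>Two floor sequences, one per end, glued at 0. Both vanish there, so every
    increment comes from a single one of the two rules.\<close>
  define a :: "int \<Rightarrow> real" where
    "a m = (if m \<ge> 0 then 2 powi k * of_int \<lfloor>y * of_int m\<rfloor> else 2 powi k' * of_int \<lfloor>y' * of_int m\<rfloor>)" for m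
  have a_right: "a m = 2 powi k * of_int \<lfloor>y * of_int m\<rfloor>" if "m \<ge> 0" for m
    using that by (simp add: a_def)
  have a_left: "a m = 2 powi k' * of_int \<lfloor>y' * of_int m\<rfloor>" if "m \<le> 0" for m
    using that by (cases "m = 0") (simp_all add: a_def)
  have diff: "\<exists>i\<in>{k, k'}. a (m + 1) - a m = 2 powi i \<or> a (m + 1) - a m = 2 powi (i + 1)" for m
  proof -
    have step: "2 powi i * of_int \<lfloor>z * of_int (m + 1)\<rfloor> - 2 powi i * of_int \<lfloor>z * of_int m\<rfloor> = (2 powi i :: real) \<or>
        2 powi i * of_int \<lfloor>z * of_int (m + 1)\<rfloor> - 2 powi i * of_int \<lfloor>z * of_int m\<rfloor> = (2 powi (i + 1) :: real)"
      if "1 \<le> z" "z < 2" for i :: int and z :: real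
    proof -
      have "of_int \<lfloor>z * of_int (m + 1)\<rfloor> - of_int \<lfloor>z * of_int m\<rfloor> \<in> {1, 2 :: real}"
        using floor_mult_step[OF that, of m] by (auto simp flip: of_int_diff)
      then show ?thesis
        by (auto simp: power_int_add simp flip: right_diff_distrib)
    qed
    show ?thesis
      using step[OF r(1,2), of k] step[OF l(1,2), of k'] a_right[of m] a_right[of "m + 1"]
        a_left[of m] a_left[of "m + 1"]
      by (cases "m \<ge> 0") auto
  qed
  define \<delta> :: real where "\<delta> = min (2 powi k) (2 powi k')"
  have \<delta>: "\<delta> > 0" "\<And>m. a (m + 1) - a m \<ge> \<delta>"
  proof -
    show "\<delta> > 0" by (simp add: \<delta>_def)
    fix m
    have "(2::real) powi i \<le> 2 powi (i + 1)" for i :: int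
      by (simp add: power_int_add)
    then show "a (m + 1) - a m \<ge> \<delta>"
      using diff[of m] unfolding \<delta>_def by (smt (verit) insert_iff singletonD)
  qed
  have "interpolate a \<in> PL2"
  proof (rule interpolate_PL2[where a = a, OF \<delta>])
    show "a m \<in> dyadics" for m
      unfolding a_def by (simp add: dyadics_mult dyadics_powi dyadics_of_int)
    show "dyadic_slope (a (m + 1) - a m)" for m
      using diff[of m] dyadic_slope_powi by metis
  qed
  moreover have "strict_mono (interpolate a)"
    by (rule strict_mono_interpolate[where a = a, OF \<delta>])
  moreover have "eventually_int_periodic_affine (interpolate a) p q p' q'"
  proof -
    have right: "a (m + p) = a m + of_int q" if "m \<ge> 0" for m
    proof -
      have "y * of_int (m + p) = y * of_int m + of_int w"
        using r(5) by (simp add: algebra_simps)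
      then show ?thesis
        using that r(3,6) by (simp add: a_right algebra_simps)
    qed
    have left: "a (m + p') = a m + of_int q'" if "m + p' \<le> 0" for m
    proof -
      have "y' * of_int (m + p') = y' * of_int m + of_int w'"
        using l(5) by (simp add: algebra_simps)
      then show ?thesis
        using that l(3,6) by (simp add: a_left algebra_simps)
    qed
    have R: "interpolate a (t + of_int p) = interpolate a t + of_int q" if "t \<ge> 0" for t
      using that by (intro interpolate_shift right) auto
    \<comment> \<open>The bound \<open>- p' - 1\<close> keeps both shifted nodes, up to
      \<open>\<lfloor>t\<rfloor> + 1 + p'\<close>, at or below 0, where the left rule holds.\<close>
    have L: "interpolate a (t + of_int p') = interpolate a t + of_int q'"
      if "t \<le> of_int (- p' - 1)" for t
    proof -
      have "\<lfloor>t\<rfloor> \<le> - p' - 1"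
        using that by linarith
      then show ?thesis
        by (intro interpolate_shift left) auto
    qed
    have "periodic_affine at_top (interpolate a) p q"
      unfolding periodic_affine_def by (rule eventually_mono[OF eventually_ge_at_top R])
    moreover have "periodic_affine at_bot (interpolate a) p' q'"
      unfolding periodic_affine_def by (rule eventually_mono[OF eventually_le_at_bot L])
    ultimately show ?thesis
      by (simp add: eventually_int_periodic_affine_iff)
  qed
  ultimately show ?thesis
    using r l by blast
qed

section \<open>The target group, surjectivity and the homomorphism\<close>

lemma group_pos_rat_group: "group pos_rat_group"
proof (rule groupI)
  show "\<exists>y\<in>carrier pos_rat_group. y \<otimes>\<^bsub>pos_rat_group\<^esub> x = \<one>\<^bsub>pos_rat_group\<^esub>"
    if "x \<in> carrier pos_rat_group" for x
    using that by (intro bexI[of _ "inverse x"]) (auto simp: pos_rat_group_def)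
qed (auto simp: pos_rat_group_def mult.assoc)

lemma pos_rat_cases:
  assumes "(x::rat) > 0"
  obtains n d :: int where "n > 0" "d > 0" "x = of_int n / of_int d"
proof -
  obtain n d where nd: "quotient_of x = (n, d)"
    by (cases "quotient_of x")
  have d: "d > 0" and x: "x = of_int n / of_int d"
    using quotient_of_denom_pos[OF nd] quotient_of_div[OF nd] by auto
  then have "n > 0"
    using assms by (simp add: zero_less_divide_iff)
  then show ?thesis
    using that d x by blast
qed

lemma end_ratios_image:
  "end_ratios ` carrier Com_plus_F = carrier (pos_rat_group \<times>\<times> pos_rat_group)"
proof
  show "end_ratios ` carrier Com_plus_F \<subseteq> carrier (pos_rat_group \<times>\<times> pos_rat_group)"
  proof (rule image_subsetI)
    fix c assume "c \<in> carrier Com_plus_F"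
    then obtain f where c: "c \<in> carrier (abstract_commensurator thompson_F)"
      and f: "f \<in> PL2" "strict_mono f" "induces f c"
      by (auto simp: Com_plus_F_iff)
    obtain p q p' q' where pos: "p > 0" "q > 0" "p' > 0" "q' > 0"
      and per: "eventually_int_periodic_affine f p q p' q'"
      using induces_periods[OF c f] by blast
    show "end_ratios c \<in> carrier (pos_rat_group \<times>\<times> pos_rat_group)"
      using pos by (simp add: end_ratios_eq[OF c f pos per] pos_rat_group_def)
  qed
  show "carrier (pos_rat_group \<times>\<times> pos_rat_group) \<subseteq> end_ratios ` carrier Com_plus_F"
  proof
    fix v assume "v \<in> carrier (pos_rat_group \<times>\<times> pos_rat_group)"
    then obtain x x' where v: "v = (x, x')" "x > 0" "x' > 0"
      by (auto simp: pos_rat_group_def)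
    \<comment> \<open>The ratio of period to increment is the reciprocal of the average slope;
      writing \<open>x\<close> as \<open>d / n\<close> therefore asks for average slope
      \<open>n / d\<close> at the right end.\<close>
    obtain d n where x: "d > 0" "n > 0" "x = of_int d / of_int n"
      using pos_rat_cases[OF v(2)] by metis
    obtain d' n' where x': "d' > 0" "n' > 0" "x' = of_int d' / of_int n'"
      using pos_rat_cases[OF v(3)] by metis
    obtain f p q p' q' where f: "f \<in> PL2" "strict_mono f"
      and pos: "p > 0" "q > 0" "p' > 0" "q' > 0" and eq: "p * n = q * d" "p' * n' = q' * d'"
      and per: "eventually_int_periodic_affine f p q p' q'"
      using exists_PL2_with_ratios[OF x(2,1) x'(2,1)] by blast
    obtain c where c: "c \<in> carrier Com_plus_F" "induces f c"
      using inducer_commensuration[OF f per pos] by blast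
    have "end_ratios c = (of_int p / of_int q, of_int p' / of_int q')"
      using c by (intro end_ratios_eq[OF _ f _ pos per]) (simp_all add: Com_plus_F_iff)
    also have "\<dots> = v"
      using cross_mult_rat[of d q p n] cross_mult_rat[of d' q' p' n'] eq pos x x'
      by (simp add: v(1) mult.commute)
    finally show "v \<in> end_ratios ` carrier Com_plus_F"
      using c(1) by blast
  qed
qed

theorem proposition4p2:
  shows "\<exists>\<Phi>. group_hom Com_plus_F (pos_rat_group \<times>\<times> pos_rat_group) \<Phi> \<and>
    \<Phi> ` carrier Com_plus_F = carrier (pos_rat_group \<times>\<times> pos_rat_group) \<and>
    (\<forall>c\<in>carrier Com_plus_F. \<forall>f\<in>PL2. strict_mono f \<and> induces f c \<longrightarrow>
      (\<exists>p q p' q'. p > 0 \<and> q > 0 \<and> p' > 0 \<and> q' > 0 \<and>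
         eventually_int_periodic_affine f p q p' q') \<and>
      (\<forall>p q p' q'. p > 0 \<and> q > 0 \<and> p' > 0 \<and> q' > 0 \<and>
         eventually_int_periodic_affine f p q p' q' \<longrightarrow>
         \<Phi> c = (of_int p / of_int q, of_int p' / of_int q')))"
proof (intro exI[of _ end_ratios] conjI ballI impI allI)
  have "end_ratios \<in> hom Com_plus_F (pos_rat_group \<times>\<times> pos_rat_group)"
  proof (rule homI)
    fix c d assume c: "c \<in> carrier Com_plus_F" and d: "d \<in> carrier Com_plus_F"
    show "end_ratios c \<in> carrier (pos_rat_group \<times>\<times> pos_rat_group)"
      using end_ratios_image c by blast
    show "end_ratios (c \<otimes>\<^bsub>Com_plus_F\<^esub> d) =
        end_ratios c \<otimes>\<^bsub>pos_rat_group \<times>\<times> pos_rat_group\<^esub> end_ratios d"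
      unfolding end_ratios_mult[OF c d]
      by (cases "end_ratios c"; cases "end_ratios d") (simp add: pos_rat_group_def)
  qed
  then show "group_hom Com_plus_F (pos_rat_group \<times>\<times> pos_rat_group) end_ratios"
    by (intro group_hom.intro group_hom_axioms.intro group_Com_plus_F DirProd_group group_pos_rat_group)
  show "end_ratios ` carrier Com_plus_F = carrier (pos_rat_group \<times>\<times> pos_rat_group)"
    by (rule end_ratios_image)
next
  fix c f assume c: "c \<in> carrier Com_plus_F" and "f \<in> PL2" "strict_mono f \<and> induces f c"
  then have f: "f \<in> PL2" "strict_mono f" "induces f c" and cK: "c \<in> carrier (abstract_commensurator thompson_F)"
    by (auto simp: Com_plus_F_iff)
  show "\<exists>p q p' q'. p > 0 \<and> q > 0 \<and> p' > 0 \<and> q' > 0 \<and> eventually_int_periodic_affine f p q p' q'"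
    by (rule induces_periods[OF cK f])
  fix p q p' q'
  assume "p > 0 \<and> q > 0 \<and> p' > 0 \<and> q' > 0 \<and> eventually_int_periodic_affine f p q p' q'"
  then show "end_ratios c = (of_int p / of_int q, of_int p' / of_int q')"
    using end_ratios_eq[OF cK f] by blast
qed

end
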